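(* Let $n$ be a natural number and let $\gamma$ (possibly depending on $n$) satisfy $0<\gamma<\frac12$. Then $$\widetilde{\deg}_{\frac12-\gamma}(\mathsf{OS}_{2^n}) = \Omega\left(\frac{n}{\log^2 n} - \log\frac{1}{\gamma}\right),$$ i.e., every real polynomial that $(\frac12-\gamma)$-approximates $\mathsf{OS}_{2^n}$ has degree $\Omega\left(\frac{n}{\log^2 n} - \log\frac{1}{\gamma}\right)$.
   Context: For a partial Boolean function $f:D\to\{0,1\}$ with $D\subseteq\{0,1\}^N$ and $0<\varepsilon<\frac12$, a real polynomial $p:\{0,1\}^N\to\mathbb{R}$ is an $\varepsilon$-approximation to $f$ if $|p(y)-f(y)|\le\varepsilon$ for every $y\in D$ and $-\varepsilon\le p(y)\le 1+\varepsilon$ for every $y\in\{0,1\}^N$. The $\varepsilon$-approximate degree $\widetilde{\deg}_\varepsilon(f)$ is the least degree of such a polynomial. The ordered search function $\mathsf{OS}_{2^n}$ is the partial function on $\{0,1\}^{2^n}$ with domain $\{0^k1^{2^n-k} : k\in\{0,1,\dots,2^n-1\}\}$, defined by $\mathsf{OS}_{2^n}(0^k1^{2^n-k}) = \mathsf{parity}(x)$, where $x\in\{0,1\}^n$ is the $n$-bit binary representation of $k$ and $\mathsf{parity}(x)=x_1\oplus\cdots\oplus x_n$. Logarithms are base 2. *)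

theory Defs
  imports Complex_Main "HOL-Library.Poly_Mapping"
begin

text \<open>
  A multivariate polynomial in the variables \<open>x\<^sub>0, x\<^sub>1, \<dots>\<close> is a finitely supported map from
  exponent vectors (themselves finitely supported) to coefficients.  Points of the Boolean cube
  \<open>{0,1}\<^sup>N\<close> are Boolean lists of length \<open>N\<close>, with \<open>True\<close> for 1 and \<open>False\<close> for 0;
  \<open>x\<^sub>i\<close> takes the value of the list entry with index \<open>i\<close> (counted from 0).
\<close>

type_synonym real_mpoly = "(nat \<Rightarrow>\<^sub>0 nat) \<Rightarrow>\<^sub>0 real"

definition mpoly_vars :: "real_mpoly \<Rightarrow> nat set" where
  "mpoly_vars p = (\<Union>m\<in>Poly_Mapping.keys p. Poly_Mapping.keys m)"

definition monom_eval :: "(nat \<Rightarrow>\<^sub>0 nat) \<Rightarrow> bool list \<Rightarrow> real" where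
  "monom_eval m y = (\<Prod>i\<in>Poly_Mapping.keys m. of_bool (y ! i) ^ Poly_Mapping.lookup m i)"

definition mpoly_eval :: "real_mpoly \<Rightarrow> bool list \<Rightarrow> real" where
  "mpoly_eval p y = (\<Sum>m\<in>Poly_Mapping.keys p. Poly_Mapping.lookup p m * monom_eval m y)"

definition monom_degree :: "(nat \<Rightarrow>\<^sub>0 nat) \<Rightarrow> nat" where
  "monom_degree m = (\<Sum>i\<in>Poly_Mapping.keys m. Poly_Mapping.lookup m i)"

text \<open>The zero polynomial gets degree 0.\<close>

definition total_degree :: "real_mpoly \<Rightarrow> nat" where
  "total_degree p = Max (insert 0 (monom_degree ` Poly_Mapping.keys p))"

text \<open>
  A partial Boolean function on \<open>{0,1}\<^sup>N\<close> is a map \<open>f\<close> whose domain consists of lists of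
  length \<open>N\<close>.
\<close>

definition approximates :: "nat \<Rightarrow> real \<Rightarrow> (bool list \<rightharpoonup> bool) \<Rightarrow> real_mpoly \<Rightarrow> bool" where
  "approximates N \<epsilon> f p \<longleftrightarrow>
     mpoly_vars p \<subseteq> {..<N} \<and>
     (\<forall>y\<in>dom f. \<bar>mpoly_eval p y - of_bool (the (f y))\<bar> \<le> \<epsilon>) \<and>
     (\<forall>y. length y = N \<longrightarrow> - \<epsilon> \<le> mpoly_eval p y \<and> mpoly_eval p y \<le> 1 + \<epsilon>)"

definition approx_degree :: "nat \<Rightarrow> real \<Rightarrow> (bool list \<rightharpoonup> bool) \<Rightarrow> nat" where
  "approx_degree N \<epsilon> f = (LEAST d. \<exists>p. approximates N \<epsilon> f p \<and> total_degree p = d)"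

definition parity :: "bool list \<Rightarrow> bool" where
  "parity x = foldr (\<noteq>) x False"

text \<open>The \<open>n\<close>-bit binary representation of \<open>k < 2 ^ n\<close>, most significant bit first.\<close>

definition binary_rep :: "nat \<Rightarrow> nat \<Rightarrow> bool list" where
  "binary_rep n k = map (bit k) (rev [0..<n])"

definition step_input :: "nat \<Rightarrow> nat \<Rightarrow> bool list" where
  "step_input N k = replicate k False @ replicate (N - k) True"

definition ordered_search :: "nat \<Rightarrow> (bool list \<rightharpoonup> bool)" where
  "ordered_search n =
     map_of (map (\<lambda>k. (step_input (2 ^ n) k, parity (binary_rep n k))) [0..<2 ^ n])"


lemma step_input_inj: "inj_on (step_input N) {..<N}"
proof (rule inj_onI)
  fix k l assume kl: "k \<in> {..<N}" "l \<in> {..<N}" "step_input N k = step_input N l"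
  have "length (filter Not (step_input N j)) = j" for j
    by (simp add: step_input_def)
  with kl(3) show "k = l" by metis
qed

lemma dom_ordered_search: "dom (ordered_search n) = step_input (2 ^ n) ` {0..<2 ^ n}"
  by (simp add: ordered_search_def dom_map_of_conv_image_fst image_image del: upt_conv_Nil)

lemma length_dom_ordered_search: "y \<in> dom (ordered_search n) \<Longrightarrow> length y = 2 ^ n"
  by (auto simp: dom_ordered_search step_input_def)

lemma ordered_search_step_input:
  assumes "k < 2 ^ n"
  shows "ordered_search n (step_input (2 ^ n) k) = Some (parity (binary_rep n k))"
  unfolding ordered_search_def
proof (rule map_of_is_SomeI)
  show "distinct (map fst (map (\<lambda>k. (step_input (2 ^ n) k, parity (binary_rep n k))) [0..<2 ^ n]))"
    using step_input_inj[of "2 ^ n"] by (simp add: distinct_map o_def atLeast0LessThan)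
qed (use assms in auto)

lemma monom_eval_superset:
  assumes "finite A" "Poly_Mapping.keys m \<subseteq> A"
  shows "monom_eval m y = (\<Prod>i\<in>A. of_bool (y ! i) ^ Poly_Mapping.lookup m i)"
  unfolding monom_eval_def
  by (rule prod.mono_neutral_left) (use assms in \<open>auto simp: in_keys_iff\<close>)

lemma monom_eval_add: "monom_eval (m + m') y = monom_eval m y * monom_eval m' y"
proof -
  have "Poly_Mapping.keys (m + m') \<subseteq> Poly_Mapping.keys m \<union> Poly_Mapping.keys m'" by (rule Poly_Mapping.keys_add)
  then show ?thesis
    by (simp add: monom_eval_superset[of "Poly_Mapping.keys m \<union> Poly_Mapping.keys m'"] lookup_add power_add prod.distrib)
qed

lemma mpoly_eval_superset:
  assumes "finite A" "Poly_Mapping.keys p \<subseteq> A"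
  shows "mpoly_eval p y = (\<Sum>m\<in>A. Poly_Mapping.lookup p m * monom_eval m y)"
  unfolding mpoly_eval_def
  by (rule sum.mono_neutral_left) (use assms in \<open>auto simp: in_keys_iff\<close>)

lemma mpoly_eval_add: "mpoly_eval (p + q) y = mpoly_eval p y + mpoly_eval q y"
proof -
  have "Poly_Mapping.keys (p + q) \<subseteq> Poly_Mapping.keys p \<union> Poly_Mapping.keys q" by (rule Poly_Mapping.keys_add)
  then show ?thesis
    by (simp add: mpoly_eval_superset[of "Poly_Mapping.keys p \<union> Poly_Mapping.keys q"] lookup_add distrib_right sum.distrib)
qed

lemma mpoly_eval_0 [simp]: "mpoly_eval 0 y = 0"
  by (simp add: mpoly_eval_def)

lemma mpoly_eval_single [simp]: "mpoly_eval (Poly_Mapping.single m c) y = c * monom_eval m y"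
  by (cases "c = 0") (simp_all add: mpoly_eval_def)

lemma mpoly_eval_sum: "mpoly_eval (\<Sum>a\<in>A. P a) y = (\<Sum>a\<in>A. mpoly_eval (P a) y)"
  by (induction A rule: infinite_finite_induct) (simp_all add: mpoly_eval_add)

lemma mpoly_vars_add: "mpoly_vars (p + q) \<subseteq> mpoly_vars p \<union> mpoly_vars q"
  using Poly_Mapping.keys_add[of p q] by (auto simp: mpoly_vars_def)

lemma mpoly_vars_sum: "mpoly_vars (\<Sum>a\<in>A. P a) \<subseteq> (\<Union>a\<in>A. mpoly_vars (P a))"
proof (induction A rule: infinite_finite_induct)
  case (insert a A)
  then show ?case using mpoly_vars_add[of "P a" "\<Sum>a\<in>A. P a"] by auto
qed (auto simp: mpoly_vars_def)

lemma ex_mpoly_literal_mult: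
  assumes p: "mpoly_vars p \<subseteq> {..<N}" and i: "i < N"
  shows "\<exists>q. mpoly_vars q \<subseteq> {..<N} \<and>
             (\<forall>y. mpoly_eval q y = mpoly_eval p y * (a + b * of_bool (y ! i)))"
proof -
  let ?e = "Poly_Mapping.single i (1 :: nat)"
  let ?t = "\<lambda>m. Poly_Mapping.single m (a * Poly_Mapping.lookup p m) +
                Poly_Mapping.single (m + ?e) (b * Poly_Mapping.lookup p m)"
  define q where "q = (\<Sum>m\<in>Poly_Mapping.keys p. ?t m)"
  have e: "monom_eval ?e y = of_bool (y ! i)" for y
    by (simp add: monom_eval_def)
  have "mpoly_eval q y = mpoly_eval p y * (a + b * of_bool (y ! i))" for y
    unfolding q_def mpoly_eval_sum mpoly_eval_add mpoly_eval_single monom_eval_add e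
    unfolding mpoly_eval_def sum_distrib_right
    by (rule sum.cong) (simp_all add: algebra_simps)
  moreover have "mpoly_vars (?t m) \<subseteq> {..<N}" if m: "m \<in> Poly_Mapping.keys p" for m
  proof -
    have 1: "Poly_Mapping.keys m \<subseteq> {..<N}" using p m by (auto simp: mpoly_vars_def)
    moreover have "Poly_Mapping.keys (m + ?e) \<subseteq> {..<N}"
      using Poly_Mapping.keys_add[of m ?e] 1 i by auto
    ultimately show ?thesis
      using Poly_Mapping.keys_add[of "Poly_Mapping.single m (a * Poly_Mapping.lookup p m)"
          "Poly_Mapping.single (m + ?e) (b * Poly_Mapping.lookup p m)"]
      by (auto simp: mpoly_vars_def split: if_splits)
  qed
  then have "mpoly_vars q \<subseteq> {..<N}"
    unfolding q_def using mpoly_vars_sum[of ?t "Poly_Mapping.keys p"] by blast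
  ultimately show ?thesis by blast
qed

lemma ex_mpoly_point:
  assumes "n \<le> N"
  shows "\<exists>p. mpoly_vars p \<subseteq> {..<N} \<and>
             (\<forall>y. mpoly_eval p y = of_bool (\<forall>i<n. y ! i = z ! i))"
  using assms
proof (induction n)
  case 0
  have "mpoly_vars (Poly_Mapping.single 0 1) \<subseteq> {..<N}"
    by (simp add: mpoly_vars_def)
  moreover have "mpoly_eval (Poly_Mapping.single 0 1) y = 1" for y
    unfolding mpoly_eval_single by (simp add: monom_eval_def)
  ultimately show ?case
    by (intro exI[of _ "Poly_Mapping.single 0 1"]) (simp del: single_one mpoly_eval_single)
next
  case (Suc n)
  then obtain p where p: "mpoly_vars p \<subseteq> {..<N}"
    "\<And>y. mpoly_eval p y = of_bool (\<forall>i<n. y ! i = z ! i)" by auto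
  obtain q where q: "mpoly_vars q \<subseteq> {..<N}"
    "\<And>y. mpoly_eval q y = mpoly_eval p y *
       ((if z ! n then 0 else 1) + (if z ! n then 1 else - 1) * of_bool (y ! n))"
    using ex_mpoly_literal_mult[OF p(1), of n] Suc.prems by (metis Suc_le_lessD)
  have "mpoly_eval q y = of_bool (\<forall>i<Suc n. y ! i = z ! i)" for y
    by (auto simp: q(2) p(2) less_Suc_eq)
  with q(1) show ?case by blast
qed

lemma ex_approximates:
  assumes "0 \<le> \<epsilon>" and dom: "\<And>y. y \<in> dom f \<Longrightarrow> length y = N"
  shows "\<exists>p. approximates N \<epsilon> f p"
proof -
  define T where "T = {z. length z = N \<and> f z = Some True}"
  have "finite {z :: bool list. set z \<subseteq> UNIV \<and> length z = N}"
    by (rule finite_lists_length_eq) simp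
  then have T: "finite T" by (rule rev_finite_subset) (auto simp: T_def)
  obtain P where P: "\<And>z. mpoly_vars (P z) \<subseteq> {..<N}"
    "\<And>z y. mpoly_eval (P z) y = of_bool (\<forall>i<N. y ! i = z ! i)"
    using ex_mpoly_point[of N N] by (metis order_refl)
  have eval: "mpoly_eval (\<Sum>z\<in>T. P z) y = of_bool (f y = Some True)" if y: "length y = N" for y
  proof -
    have "mpoly_eval (\<Sum>z\<in>T. P z) y = (\<Sum>z\<in>T. if z = y then 1 else 0)"
      unfolding mpoly_eval_sum
      by (rule sum.cong) (use y in \<open>auto simp: P(2) T_def list_eq_iff_nth_eq\<close>)
    also have "\<dots> = of_bool (f y = Some True)"
      using T y by (simp add: T_def)
    finally show ?thesis .
  qed
  have "mpoly_vars (\<Sum>z\<in>T. P z) \<subseteq> {..<N}"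
    using mpoly_vars_sum[of P T] P(1) by blast
  then have "approximates N \<epsilon> f (\<Sum>z\<in>T. P z)"
    using assms by (auto simp: approximates_def eval dest: domI)
  then show ?thesis by blast
qed

end

theory Submission
  imports Defs "HOL-Complex_Analysis.Complex_Analysis" "HOL-Library.Nat_Bijection" "HOL-Real_Asymp.Real_Asymp"
begin

text \<open>
  Encode a set \<open>X \<subseteq> {..<2t}\<close> as the number \<open>k\<close> with binary digits \<open>X\<close> followed by one more bit, chosen
  so that the parity of \<open>k\<close> is a bent function \<open>\<sigma>\<close> of \<open>X\<close>; no character of \<open>X\<close> correlates with \<open>\<sigma>\<close>
  by more than \<open>2\<^sup>-\<^sup>t\<close>.  Each input bit \<open>[k \<le> i]\<close> of ordered search is a sum of at most \<open>n\<close> equality tests on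
  suffixes of \<open>X\<close>.  A small-bias family of characters gives an approximate test \<open>q\<close> of degree
  \<open>L = O(log n)\<close> in \<open>O(n\<^sup>2)\<close> signs \<open>z\<close> that are characters of \<open>X\<close>: \<open>q\<close> is 1 if the test succeeds
  and at most \<open>(3/4)\<^sup>L\<close> otherwise.  Replace every test by a polynomial in an auxiliary variable \<open>s\<close>
  that starts with \<open>q + \<Sum>\<^sub>k s\<^sup>k (q\<^sup>k\<^sup>+\<^sup>1 - q\<^sup>k)\<close> and is the exact test at \<open>s = 1\<close>.  Substituted into the
  approximating polynomial of degree \<open>d\<close>, this gives a polynomial \<open>h\<close> in \<open>s\<close> whose coefficient of \<open>s\<^sup>k\<close>
  has degree at most \<open>(d + k) L\<close> in \<open>z\<close>.  A polynomial bounded on the cube grows at most like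
  \<open>(C r)\<^sup>d\<close> on complex polydiscs of radius \<open>r\<close>, so Cauchy's inequality bounds the coefficients of \<open>h\<close>:
  for all signs \<open>z\<close> with radius \<open>1/2\<close>, and for those coming from some \<open>X\<close> with radius \<open>(4/3)\<^sup>L / 2\<close>.
  The second bound makes the coefficients beyond \<open>m = \<Theta>(n / log\<^sup>2 n)\<close> negligible; the first shows
  that the remaining ones have a small Fourier norm, hence correlate negligibly with \<open>\<sigma>\<close>.
\<close>

section \<open>Characters of the cube\<close>

text \<open>Walsh character, with sets standing for both frequencies and points of the cube; its
  symmetry lets later proofs exchange the two roles.\<close>

definition chi :: "'a set \<Rightarrow> 'a set \<Rightarrow> real" where
  "chi S Z = (-1) ^ card (S \<inter> Z)"

lemma chi_empty [simp]: "chi {} Z = 1" "chi S {} = 1"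
  by (simp_all add: chi_def)

lemma chi_commute: "chi S Z = chi Z S"
  by (simp add: chi_def Int_commute)

lemma abs_chi [simp]: "\<bar>chi S Z\<bar> = 1"
  by (simp add: chi_def power_abs)

lemma chi_cases: "chi S Z = 1 \<or> chi S Z = - 1"
  by (cases "even (card (S \<inter> Z))") (simp_all add: chi_def)

lemma chi_mult_self [simp]: "chi S Z * chi S Z = 1"
  using chi_cases[of S Z] by auto

lemma chi_singleton: "chi {v} Z = (if v \<in> Z then - 1 else 1)"
  by (simp add: chi_def)

lemma chi_Int_shift: "chi (S \<inter> A) Z = chi S (Z \<inter> A)"
  by (simp add: chi_def Int_ac)

lemma chi_eq_prod: "finite S \<Longrightarrow> chi S Z = (\<Prod>v\<in>S. chi {v} Z)"
proof (induction S rule: finite_induct)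
  case (insert v S)
  have "card (insert v S \<inter> Z) = card ({v} \<inter> Z) + card (S \<inter> Z)"
    using insert.hyps by (subst card_Un_disjoint[symmetric]) (auto intro: arg_cong[where f = card])
  with insert show ?case by (simp add: chi_def power_add)
qed simp

lemma chi_sym_diff:
  assumes "finite S" "finite T"
  shows "chi (sym_diff S T) Z = chi S Z * chi T Z"
proof -
  define f where "f v = chi {v} Z" for v
  have f: "f v * f v = 1" for v by (simp add: f_def)
  have S: "(\<Prod>v\<in>S. f v) = (\<Prod>v\<in>S - T. f v) * (\<Prod>v\<in>S \<inter> T. f v)"
    using assms by (subst prod.union_disjoint[symmetric]) (auto intro: prod.cong)
  have T: "(\<Prod>v\<in>T. f v) = (\<Prod>v\<in>T - S. f v) * (\<Prod>v\<in>S \<inter> T. f v)"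
    using assms by (subst prod.union_disjoint[symmetric]) (auto intro: prod.cong)
  have D: "(\<Prod>v\<in>sym_diff S T. f v) = (\<Prod>v\<in>S - T. f v) * (\<Prod>v\<in>T - S. f v)"
    using assms by (subst prod.union_disjoint[symmetric]) auto
  have I: "(\<Prod>v\<in>S \<inter> T. f v) * (\<Prod>v\<in>S \<inter> T. f v) = 1"
    by (simp add: prod.distrib[symmetric] f)
  show ?thesis
    unfolding chi_eq_prod[OF assms(1)] chi_eq_prod[OF assms(2)]
      chi_eq_prod[OF finite_UnI[OF finite_Diff[OF assms(1)] finite_Diff[OF assms(2)]]]
      f_def[symmetric] S T D
    using I by (simp add: mult_ac)
qed

text \<open>Toggling a fixed element of a nonempty \<open>S\<close> permutes the cube and reverses
  the sign, so the sum is its own negative.\<close>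

lemma sum_chi_Pow:
  assumes "finite V" "S \<subseteq> V"
  shows "(\<Sum>Z\<in>Pow V. chi S Z) = (if S = {} then 2 ^ card V else 0)"
proof (cases "S = {}")
  case True
  then show ?thesis using assms by (simp add: card_Pow)
next
  case False
  then obtain v where v: "v \<in> S" by blast
  have flip: "chi S (sym_diff Z {v}) = - chi S Z" if "Z \<subseteq> V" for Z
  proof -
    have "chi S (sym_diff Z {v}) = chi S Z * chi S {v}"
      using chi_sym_diff[of Z "{v}" S] that assms
      by (simp add: chi_commute[of S] finite_subset)
    then show ?thesis using v by (simp add: chi_commute[of S "{v}"] chi_singleton)
  qed
  have "(\<Sum>Z\<in>Pow V. chi S Z) = (\<Sum>Z\<in>Pow V. chi S (sym_diff Z {v}))"
    by (rule sum.reindex_bij_witness[of _ "\<lambda>Z. sym_diff Z {v}" "\<lambda>Z. sym_diff Z {v}"])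
       (use v assms in \<open>auto intro: arg_cong[where f = "chi S"]\<close>)
  also have "\<dots> = - (\<Sum>Z\<in>Pow V. chi S Z)"
    by (simp add: flip sum_negf)
  finally show ?thesis using False by simp
qed

lemma sum_chi_mult_chi:
  assumes "finite V" "S \<subseteq> V" "T \<subseteq> V"
  shows "(\<Sum>Z\<in>Pow V. chi S Z * chi T Z) = (if S = T then 2 ^ card V else 0)"
proof -
  have "(\<Sum>Z\<in>Pow V. chi S Z * chi T Z) = (\<Sum>Z\<in>Pow V. chi (sym_diff S T) Z)"
    using assms finite_subset[OF _ assms(1)] by (simp add: chi_sym_diff)
  also have "\<dots> = (if sym_diff S T = {} then 2 ^ card V else 0)"
    using assms by (intro sum_chi_Pow) auto
  also have "sym_diff S T = {} \<longleftrightarrow> S = T" by auto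
  finally show ?thesis .
qed

section \<open>Functions of low Fourier degree\<close>

text \<open>Finite combinations of characters of frequency size at most \<open>D\<close>.
  Frequencies may repeat, so closure under sums and products follows by induction without collecting
  terms.\<close>

inductive lowdeg :: "'a set \<Rightarrow> nat \<Rightarrow> ('a set \<Rightarrow> complex) \<Rightarrow> bool" for V D where
  lowdeg_0: "lowdeg V D (\<lambda>Z. 0)"
| lowdeg_step: "S \<subseteq> V \<Longrightarrow> card S \<le> D \<Longrightarrow> lowdeg V D F \<Longrightarrow>
    lowdeg V D (\<lambda>Z. c * of_real (chi S Z) + F Z)"

lemma lowdeg_mono: "lowdeg V D F \<Longrightarrow> D \<le> D' \<Longrightarrow> lowdeg V D' F"
  by (induction rule: lowdeg.induct) (auto intro: lowdeg.intros)

lemma lowdeg_chi: "S \<subseteq> V \<Longrightarrow> card S \<le> D \<Longrightarrow> lowdeg V D (\<lambda>Z. c * of_real (chi S Z))"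
  using lowdeg_step[OF _ _ lowdeg_0] by fastforce

lemma lowdeg_const: "lowdeg V D (\<lambda>Z. c)"
  using lowdeg_chi[of "{}" V D c] by simp

lemma lowdeg_add: "lowdeg V D F \<Longrightarrow> lowdeg V D G \<Longrightarrow> lowdeg V D (\<lambda>Z. F Z + G Z)"
proof (induction rule: lowdeg.induct)
  case (lowdeg_step S F c)
  then show ?case using lowdeg.lowdeg_step[of S V D "\<lambda>Z. F Z + G Z" c] by (simp add: add.assoc)
qed simp

lemma lowdeg_sum: "(\<And>a. a \<in> A \<Longrightarrow> lowdeg V D (F a)) \<Longrightarrow> lowdeg V D (\<lambda>Z. \<Sum>a\<in>A. F a Z)"
  by (induction A rule: infinite_finite_induct) (auto intro: lowdeg_const lowdeg_add)

lemma lowdeg_chi_mult: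
  assumes "finite V" "S \<subseteq> V" "card S \<le> D" "lowdeg V D' F"
  shows "lowdeg V (D + D') (\<lambda>Z. c * of_real (chi S Z) * F Z)"
  using assms(4)
proof (induction rule: lowdeg.induct)
  case lowdeg_0
  show ?case using lowdeg.lowdeg_0 by simp
next
  case (lowdeg_step T F c')
  have fin: "finite S" "finite T" using assms lowdeg_step finite_subset by auto
  have "card (sym_diff S T) \<le> card (S \<union> T)" by (rule card_mono) (use fin in auto)
  also have "\<dots> \<le> D + D'" using card_Un_le[of S T] assms lowdeg_step by linarith
  finally have "lowdeg V (D + D') (\<lambda>Z. (c * c') * of_real (chi (sym_diff S T) Z) + c * of_real (chi S Z) * F Z)"
    using assms lowdeg_step by (intro lowdeg.lowdeg_step) auto
  then show ?case by (simp add: chi_sym_diff[OF fin] algebra_simps)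
qed

lemma lowdeg_mult:
  assumes "finite V" "lowdeg V D F" "lowdeg V D' G"
  shows "lowdeg V (D + D') (\<lambda>Z. F Z * G Z)"
  using assms(2)
proof (induction rule: lowdeg.induct)
  case lowdeg_0
  show ?case using lowdeg.lowdeg_0 by simp
next
  case (lowdeg_step S F c)
  then show ?case
    using lowdeg_add[OF lowdeg_chi_mult[OF assms(1) lowdeg_step(1,2) assms(3), of c]]
    by (simp add: algebra_simps)
qed

lemma lowdeg_cmult: "finite V \<Longrightarrow> lowdeg V D F \<Longrightarrow> lowdeg V D (\<lambda>Z. c * F Z)"
  using lowdeg_mult[OF _ lowdeg_const[of V 0 c]] by fastforce

lemma lowdeg_power: "finite V \<Longrightarrow> lowdeg V D F \<Longrightarrow> lowdeg V (k * D) (\<lambda>Z. F Z ^ k)"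
  by (induction k) (auto intro: lowdeg_const lowdeg_mult)

section \<open>Fourier expansion and the number of low frequencies\<close>

definition fourier_coeff :: "'a set \<Rightarrow> ('a set \<Rightarrow> complex) \<Rightarrow> 'a set \<Rightarrow> complex" where
  "fourier_coeff V F S = (\<Sum>Z\<in>Pow V. F Z * of_real (chi S Z)) / 2 ^ card V"

lemma norm_fourier_coeff_le:
  assumes "finite V" "\<And>Z. Z \<subseteq> V \<Longrightarrow> norm (F Z) \<le> B"
  shows "norm (fourier_coeff V F S) \<le> B"
proof -
  have "norm (\<Sum>Z\<in>Pow V. F Z * of_real (chi S Z)) \<le> (\<Sum>Z\<in>Pow V. B)"
    by (rule sum_norm_le) (use assms in \<open>auto simp: norm_mult\<close>)
  also have "\<dots> = 2 ^ card V * B" using assms by (simp add: card_Pow)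
  finally show ?thesis
    by (simp add: fourier_coeff_def norm_divide norm_power divide_le_eq mult.commute)
qed

text \<open>By orthogonality, each construction step alters only the coefficient at its own
  frequency.\<close>

lemma lowdeg_fourier_expansion:
  assumes "finite V" "lowdeg V D F"
  shows "F Z = (\<Sum>S | S \<subseteq> V \<and> card S \<le> D. fourier_coeff V F S * of_real (chi S Z))"
  using assms(2)
proof (induction rule: lowdeg.induct)
  case lowdeg_0
  then show ?case by (simp add: fourier_coeff_def)
next
  case (lowdeg_step T F c)
  let ?G = "\<lambda>Z. c * of_real (chi T Z) + F Z"
  have fin: "finite {S. S \<subseteq> V \<and> card S \<le> D}"
    using assms(1) by (rule finite_subset[rotated, OF finite_Pow_iff[THEN iffD2]]) auto
  have coeff: "fourier_coeff V ?G S = (if S = T then c else 0) + fourier_coeff V F S" if "S \<subseteq> V" for S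
  proof -
    have "(\<Sum>Z\<in>Pow V. c * of_real (chi T Z) * of_real (chi S Z))
        = c * of_real (\<Sum>Z\<in>Pow V. chi T Z * chi S Z)"
      by (simp add: sum_distrib_left mult.assoc)
    also have "\<dots> = (if S = T then c * 2 ^ card V else 0)"
      using sum_chi_mult_chi[OF assms(1) lowdeg_step(1) that] by auto
    finally show ?thesis
      by (simp add: fourier_coeff_def distrib_right sum.distrib add_divide_distrib)
  qed
  have "(\<Sum>S | S \<subseteq> V \<and> card S \<le> D. fourier_coeff V ?G S * of_real (chi S Z))
     = (\<Sum>S | S \<subseteq> V \<and> card S \<le> D. (if S = T then c * of_real (chi T Z) else 0)
          + fourier_coeff V F S * of_real (chi S Z))"
    by (rule sum.cong) (auto simp: coeff distrib_right)
  also have "\<dots> = c * of_real (chi T Z) + F Z"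
    using lowdeg_step fin by (simp add: sum.distrib sum.delta)
  finally show ?case by simp
qed

text \<open>Raising \<open>D\<close> by one allows adding nothing or one element of
  \<open>V\<close>, hence a factor \<open>card V + 1\<close>.\<close>

lemma card_subsets_le:
  assumes "finite V"
  shows "card {S. S \<subseteq> V \<and> card S \<le> D} \<le> (card V + 1) ^ D"
proof (induction D)
  case 0
  have "{S. S \<subseteq> V \<and> card S \<le> 0} = {{}}" using finite_subset[OF _ assms] by auto
  then show ?case by simp
next
  case (Suc D)
  let ?A = "{S. S \<subseteq> V \<and> card S \<le> D}"
  let ?f = "\<lambda>(x, S). case x of None \<Rightarrow> S | Some v \<Rightarrow> insert v S"
  have fin: "finite ?A" using assms by simp
  have "{S. S \<subseteq> V \<and> card S \<le> Suc D} \<subseteq> ?f ` (insert None (Some ` V) \<times> ?A)"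
  proof
    fix S assume S: "S \<in> {S. S \<subseteq> V \<and> card S \<le> Suc D}"
    show "S \<in> ?f ` (insert None (Some ` V) \<times> ?A)"
    proof (cases "card S \<le> D")
      case True
      then show ?thesis using S by (intro image_eqI[of _ _ "(None, S)"]) auto
    next
      case False
      then obtain v where v: "v \<in> S" by fastforce
      have "finite S" using S assms finite_subset by auto
      then show ?thesis
        using S v by (intro image_eqI[of _ _ "(Some v, S - {v})"]) (auto simp: card_Diff_singleton)
    qed
  qed
  then have "card {S. S \<subseteq> V \<and> card S \<le> Suc D} \<le> card (insert None (Some ` V) \<times> ?A)"
    using fin assms by (intro surj_card_le) auto
  also have "\<dots> = (card V + 1) * card ?A"
    using assms by (simp add: card_cartesian_product card_image)
  also have "\<dots> \<le> (card V + 1) * (card V + 1) ^ D"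
    using Suc by (rule mult_le_mono2)
  finally show ?case by simp
qed

section \<open>Substituting characters of \<open>X\<close> for sign variables\<close>

definition lift_set :: "'v set \<Rightarrow> ('v \<Rightarrow> 'a set) \<Rightarrow> 'a set \<Rightarrow> 'v set" where
  "lift_set V C X = {v \<in> V. odd (card (C v \<inter> X))}"

lemma chi_singleton_lift_set: "v \<in> V \<Longrightarrow> chi {v} (lift_set V C X) = chi (C v) X"
  by (simp add: chi_singleton lift_set_def) (simp add: chi_def)

text \<open>A product of characters of \<open>X\<close> is again one character, at the symmetric
  difference of the frequencies. Flatness against single characters therefore controls every
  monomial in the sign variables.\<close>

lemma chi_lift_set:
  assumes "finite S" "S \<subseteq> V" "\<And>v. v \<in> V \<Longrightarrow> C v \<subseteq> U" "finite U"
  shows "\<exists>T\<subseteq>U. \<forall>X. chi S (lift_set V C X) = chi T X"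
  using assms(1,2)
proof (induction S rule: finite_induct)
  case empty
  then show ?case by (intro exI[of _ "{}"]) auto
next
  case (insert v S)
  then obtain T where T: "T \<subseteq> U" "\<And>X. chi S (lift_set V C X) = chi T X" by auto
  have fin: "finite (C v)" "finite T"
    using T assms(3)[of v] insert.prems assms(4) finite_subset by auto
  have "chi (insert v S) (lift_set V C X) = chi (sym_diff (C v) T) X" for X
  proof -
    have "sym_diff {v} S = insert v S" using insert.hyps by auto
    then have "chi (insert v S) (lift_set V C X) = chi {v} (lift_set V C X) * chi S (lift_set V C X)"
      using chi_sym_diff[of "{v}" S "lift_set V C X"] insert.hyps by simp
    also have "\<dots> = chi (C v) X * chi T X"
      using insert.prems T by (simp add: chi_singleton_lift_set)
    finally show ?thesis by (simp add: chi_sym_diff[OF fin])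
  qed
  moreover have "sym_diff (C v) T \<subseteq> U" using T assms(3)[of v] insert.prems by auto
  ultimately show ?case by blast
qed

text \<open>Expand \<open>F\<close>: there are at most \<open>(card V + 1) ^ D\<close> coefficients,
  each at most \<open>B\<close>, and each character pulls back to a single one of \<open>X\<close>.
  The bound \<open>B\<close> is required on all sign vectors, not only on lifts, since the
  coefficients average over all of them.\<close>

lemma lowdeg_correlation_le:
  fixes \<sigma> :: "'a set \<Rightarrow> real"
  assumes "finite V" "finite U" "\<And>v. v \<in> V \<Longrightarrow> C v \<subseteq> U"
    and flat: "\<And>T. T \<subseteq> U \<Longrightarrow> \<bar>\<Sum>X\<in>A. \<sigma> X * chi T X\<bar> \<le> \<beta>"
    and low: "lowdeg V D F" and bound: "\<And>Z. Z \<subseteq> V \<Longrightarrow> norm (F Z) \<le> B"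
  shows "norm (\<Sum>X\<in>A. of_real (\<sigma> X) * F (lift_set V C X)) \<le> \<beta> * B * (real (card V) + 1) ^ D"
proof -
  let ?L = "{S. S \<subseteq> V \<and> card S \<le> D}"
  have B: "B \<ge> 0" using bound[OF empty_subsetI] norm_ge_zero order_trans by blast
  have \<beta>: "\<beta> \<ge> 0" using flat[of "{}"] by (meson abs_ge_zero empty_subsetI order_trans)
  have "(\<Sum>X\<in>A. of_real (\<sigma> X) * F (lift_set V C X))
     = (\<Sum>X\<in>A. \<Sum>S\<in>?L. fourier_coeff V F S * of_real (\<sigma> X * chi S (lift_set V C X)))"
    by (subst lowdeg_fourier_expansion[OF assms(1) low]) (simp add: sum_distrib_left mult_ac)
  also have "\<dots> = (\<Sum>S\<in>?L. fourier_coeff V F S * of_real (\<Sum>X\<in>A. \<sigma> X * chi S (lift_set V C X)))"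
    by (subst sum.swap) (simp add: sum_distrib_left)
  also have "norm \<dots> \<le> (\<Sum>S\<in>?L. \<beta> * B)"
  proof (rule sum_norm_le)
    fix S assume S: "S \<in> ?L"
    then have "finite S" "S \<subseteq> V" using finite_subset[OF _ assms(1)] by auto
    from chi_lift_set[of S V C U, OF this assms(3,2)]
    obtain T where T: "T \<subseteq> U" "\<And>X. chi S (lift_set V C X) = chi T X" by auto
    have "norm (fourier_coeff V F S) * \<bar>\<Sum>X\<in>A. \<sigma> X * chi T X\<bar> \<le> B * \<beta>"
      by (intro mult_mono norm_fourier_coeff_le flat assms T B) auto
    then show "norm (fourier_coeff V F S * of_real (\<Sum>X\<in>A. \<sigma> X * chi S (lift_set V C X))) \<le> \<beta> * B"
      by (simp only: norm_mult norm_of_real T(2) mult.commute)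
  qed
  also have "\<dots> = \<beta> * B * real (card ?L)" by simp
  also have "\<dots> \<le> \<beta> * B * real ((card V + 1) ^ D)"
    by (intro mult_left_mono of_nat_mono card_subsets_le assms mult_nonneg_nonneg B \<beta>)
  finally show ?thesis by (simp add: add.commute)
qed

section \<open>A bent function and a small-bias family\<close>

text \<open>The inner product modulo 2 on \<open>t\<close> disjoint pairs of bits, as a
  sign.\<close>

primrec bent :: "nat \<Rightarrow> nat set \<Rightarrow> real" where
  "bent 0 X = 1"
| "bent (Suc t) X = (if 2 * t \<in> X \<and> 2 * t + 1 \<in> X then - 1 else 1) * bent t X"

lemma bent_cases: "bent t X = 1 \<or> bent t X = - 1"
  by (induction t) auto

lemma bent_insert: "2 * t \<le> j \<Longrightarrow> bent t (insert j X) = bent t X"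
  by (induction t) auto

lemma sum_Pow_insert:
  assumes "finite A" "a \<notin> A"
  shows "(\<Sum>X\<in>Pow (insert a A). f X) = (\<Sum>X\<in>Pow A. f X + f (insert a X))"
proof -
  have "Pow A \<inter> insert a ` Pow A = {}" using assms by auto
  moreover have "inj_on (insert a) (Pow A)" using assms by (auto simp: inj_on_def)
  ultimately show ?thesis
    using assms by (simp add: Pow_insert sum.union_disjoint sum.reindex sum.distrib)
qed

lemma chi_insert: "finite X \<Longrightarrow> j \<notin> X \<Longrightarrow> chi T (insert j X) = (if j \<in> T then - 1 else 1) * chi T X"
  by (simp add: chi_commute[of T] chi_eq_prod[of "insert j X"] chi_eq_prod[of X] chi_singleton)

text \<open>The four settings of a new pair contribute the factor \<open>1 + a + b - a * b\<close>,
  which is 2 or -2 for signs \<open>a\<close> and \<open>b\<close>. \<open>T\<close> is arbitrary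
  because only its part below \<open>2 * t\<close> meets \<open>X\<close>.\<close>

lemma bent_flat: "\<bar>\<Sum>X\<in>Pow {..<2 * t}. bent t X * chi T X\<bar> \<le> 2 ^ t"
proof (induction t)
  case 0
  show ?case by simp
next
  case (Suc t)
  define a :: real where "a = (if 2 * t \<in> T then - 1 else 1)"
  define b :: real where "b = (if 2 * t + 1 \<in> T then - 1 else 1)"
  have ins: "{..<2 * Suc t} = insert (2 * t) (insert (2 * t + 1) {..<2 * t})" by auto
  have "(\<Sum>X\<in>Pow {..<2 * Suc t}. bent (Suc t) X * chi T X)
      = (\<Sum>X\<in>Pow {..<2 * t}. (1 + a + b - a * b) * (bent t X * chi T X))"
    unfolding ins
  proof (subst sum_Pow_insert, simp, simp, subst sum_Pow_insert, simp, simp, intro sum.cong refl)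
    fix X assume "X \<in> Pow {..<2 * t}"
    then have X: "finite X" "2 * t \<notin> X" "Suc (2 * t) \<notin> X" "2 * t + 1 \<notin> X"
      by (auto intro: finite_subset)
    show "bent (Suc t) X * chi T X + bent (Suc t) (insert (2 * t) X) * chi T (insert (2 * t) X) +
         (bent (Suc t) (insert (2 * t + 1) X) * chi T (insert (2 * t + 1) X) +
          bent (Suc t) (insert (2 * t) (insert (2 * t + 1) X)) * chi T (insert (2 * t) (insert (2 * t + 1) X)))
        = (1 + a + b - a * b) * (bent t X * chi T X)"
      using X by (simp add: bent_insert chi_insert a_def b_def)
  qed
  also have "\<dots> = (1 + a + b - a * b) * (\<Sum>X\<in>Pow {..<2 * t}. bent t X * chi T X)"
    by (simp add: sum_distrib_left)
  also have "\<bar>\<dots>\<bar> = 2 * \<bar>\<Sum>X\<in>Pow {..<2 * t}. bent t X * chi T X\<bar>"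
    by (simp add: a_def b_def abs_mult)
  finally show ?case using Suc by simp
qed

text \<open>Greedy choice for the potential \<open>\<Sum>\<^bsub>D \<noteq> {}\<^esub> 2 powr (\<Sum>\<^sub>r chi (A r) D)\<close>: a uniformly random next
  set multiplies it by \<open>(2 + 1/2) / 2 = 5/4\<close> on average.\<close>

lemma small_bias_potential:
  assumes "finite U"
  shows "\<exists>A :: nat \<Rightarrow> 'a set. (\<forall>r. A r \<subseteq> U) \<and>
    (\<Sum>D\<in>Pow U - {{}}. 2 powr (\<Sum>r<R. chi (A r) D)) \<le> 2 ^ card U * (5 / 4) ^ R"
proof (induction R)
  case 0
  have "card (Pow U - {{}}) \<le> card (Pow U)" using assms by (intro card_mono) auto
  then have "card (Pow U - {{}}) \<le> 2 ^ card U" using assms by (simp add: card_Pow)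
  then have "real (card (Pow U - {{}})) \<le> real (2 ^ card U)" by (rule of_nat_mono)
  then show ?case by (intro exI[of _ "\<lambda>_. {}"]) simp
next
  case (Suc R)
  then obtain A where A: "\<And>r. A r \<subseteq> U"
    and pot: "(\<Sum>D\<in>Pow U - {{}}. 2 powr (\<Sum>r<R. chi (A r) D)) \<le> 2 ^ card U * (5 / 4) ^ R" by auto
  define w where "w D = 2 powr (\<Sum>r<R. chi (A r) D)" for D
  \<comment> \<open>On signs this power is affine, so averaging over \<open>B\<close> leaves just
    5/4 when \<open>D\<close> is nonempty.\<close>
  have two: "2 powr chi B D = 5 / 4 + 3 / 4 * chi B D" for B D :: "'a set"
    using chi_cases[of B D] by (auto simp: powr_minus)
  have "\<exists>B\<in>Pow U. (\<Sum>D\<in>Pow U - {{}}. w D * 2 powr chi B D) \<le> 5 / 4 * (\<Sum>D\<in>Pow U - {{}}. w D)"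
  proof (rule ccontr)
    assume "\<not> ?thesis"
    then have less: "\<And>B. B \<in> Pow U \<Longrightarrow> 5 / 4 * (\<Sum>D\<in>Pow U - {{}}. w D) < (\<Sum>D\<in>Pow U - {{}}. w D * 2 powr chi B D)"
      by (auto simp: not_le)
    have "(\<Sum>B\<in>Pow U. 5 / 4 * (\<Sum>D\<in>Pow U - {{}}. w D)) < (\<Sum>B\<in>Pow U. \<Sum>D\<in>Pow U - {{}}. w D * 2 powr chi B D)"
      using assms by (intro sum_strict_mono less) auto
    also have "\<dots> = (\<Sum>D\<in>Pow U - {{}}. w D * (\<Sum>B\<in>Pow U. 5 / 4 + 3 / 4 * chi D B))"
      by (subst sum.swap) (simp add: two sum_distrib_left chi_commute)
    also have "\<dots> = (\<Sum>D\<in>Pow U - {{}}. w D * (2 ^ card U * (5 / 4)))"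
    proof (intro sum.cong refl arg_cong2[where f = "(*)"])
      fix D assume "D \<in> Pow U - {{}}"
      then have "(\<Sum>B\<in>Pow U. chi D B) = 0" using sum_chi_Pow[OF assms, of D] by auto
      then show "(\<Sum>B\<in>Pow U. 5 / 4 + 3 / 4 * chi D B) = 2 ^ card U * (5 / 4)"
        using assms by (simp only: sum.distrib sum_distrib_left[symmetric]) (simp add: card_Pow)
    qed
    also have "\<dots> = 2 ^ card U * (5 / 4 * (\<Sum>D\<in>Pow U - {{}}. w D))"
      by (simp add: sum_distrib_left mult_ac)
    finally show False using assms by (simp add: card_Pow)
  qed
  then obtain B where B: "B \<subseteq> U"
    "(\<Sum>D\<in>Pow U - {{}}. w D * 2 powr chi B D) \<le> 5 / 4 * (\<Sum>D\<in>Pow U - {{}}. w D)" by auto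
  let ?A = "A(R := B)"
  have "(\<Sum>D\<in>Pow U - {{}}. 2 powr (\<Sum>r<Suc R. chi (?A r) D)) = (\<Sum>D\<in>Pow U - {{}}. w D * 2 powr chi B D)"
    by (intro sum.cong refl) (simp add: w_def powr_add[symmetric])
  also have "\<dots> \<le> 5 / 4 * (2 ^ card U * (5 / 4) ^ R)"
    using B(2) pot by (simp add: w_def)
  finally show ?case using A B(1) by (intro exI[of _ ?A]) auto
qed

text \<open>After \<open>6 * card U\<close> rounds the potential is at most
  \<open>(2 * (5 / 4) ^ 6) ^ card U\<close>, hence at most \<open>8 ^ card U\<close>. It dominates
  each of its terms, and taking logarithms bounds every exponent by half the number of
  rounds.\<close>

lemma small_bias_family:
  assumes "finite U"
  shows "\<exists>A :: nat \<Rightarrow> 'a set. (\<forall>r. A r \<subseteq> U) \<and>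
    (\<forall>D\<subseteq>U. D \<noteq> {} \<longrightarrow> (\<Sum>r<6 * card U. chi (A r) D) \<le> 3 * card U)"
proof -
  let ?M = "card U"
  obtain A :: "nat \<Rightarrow> 'a set" where A: "\<And>r. A r \<subseteq> U"
    and pot: "(\<Sum>D\<in>Pow U - {{}}. 2 powr (\<Sum>r<6 * ?M. chi (A r) D)) \<le> 2 ^ ?M * (5 / 4) ^ (6 * ?M)"
    using small_bias_potential[OF assms] by blast
  have "(\<Sum>r<6 * ?M. chi (A r) D) \<le> 3 * ?M" if D: "D \<subseteq> U" "D \<noteq> {}" for D
  proof -
    have "2 powr (\<Sum>r<6 * ?M. chi (A r) D) \<le> (\<Sum>D\<in>Pow U - {{}}. 2 powr (\<Sum>r<6 * ?M. chi (A r) D))"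
      by (rule member_le_sum) (use D assms in auto)
    also have "\<dots> \<le> (2 * (5 / 4) ^ 6) ^ ?M" using pot by (simp add: power_mult_distrib power_mult)
    also have "\<dots> \<le> (2 ^ 3) ^ ?M" by (rule power_mono) (auto simp: power_divide)
    also have "\<dots> = 2 powr (3 * ?M)" by (simp add: powr_realpow[symmetric] powr_powr[symmetric])
    finally show ?thesis by simp
  qed
  then show ?thesis using A by blast
qed

section \<open>Growth of polynomials bounded on the cube\<close>

lemma power_le_exp_fact: "real d ^ d \<le> exp 1 ^ d * fact d"
proof -
  have "(\<Sum>k\<in>{d}. real d ^ k /\<^sub>R fact k) \<le> exp (real d)"
    unfolding exp_def by (rule sum_le_suminf[OF summable_exp_generic]) auto
  then show ?thesis by (simp add: field_simps exp_of_nat_mult[symmetric])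
qed

lemma degree_prod_linear_le:
  assumes "finite A"
  shows "degree (\<Prod>i\<in>A. [:u i, v i :: complex:]) \<le> card A"
proof -
  have "degree (\<Prod>i\<in>A. [:u i, v i:]) \<le> (\<Sum>i\<in>A. degree [:u i, v i:])"
    using degree_prod_sum_le[OF assms, of "\<lambda>i. [:u i, v i:]"] by (simp add: o_def)
  also have "\<dots> \<le> of_nat (card A) * 1" by (rule sum_bounded_above) simp
  finally show ?thesis by simp
qed

text \<open>Lagrange interpolation at the nodes j/d. Summing the bounds on the basis polynomials
  gives 2^d d^d / d! times (|x| + 1)^d, and d^d / d! is at most e^d, being one term of the series of
  exp d.\<close>

lemma lagrange_extrapolation:
  fixes p :: "complex poly"
  assumes deg: "degree p \<le> d" and d: "d > 0"
    and bound: "\<And>j. j \<le> d \<Longrightarrow> norm (poly p (of_nat j / of_nat d)) \<le> B"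
  shows "norm (poly p x) \<le> B * (6 * (norm x + 1)) ^ d"
proof -
  let ?y = "\<lambda>j. of_nat j / of_nat d :: complex"
  define lag where "lag j = (\<Prod>i\<in>{..d} - {j}. [: - ?y i / (?y j - ?y i), 1 / (?y j - ?y i) :])" for j
  have B: "B \<ge> 0" using bound[of 0] norm_ge_zero order_trans by blast
  have y_inj: "?y i = ?y j \<longleftrightarrow> i = j" for i j using d by simp
  have poly_lag: "poly (lag j) z = (\<Prod>i\<in>{..d} - {j}. (z - ?y i) / (?y j - ?y i))" for j z
    by (simp add: lag_def poly_prod diff_divide_distrib)
  have deg_lag: "degree (lag j) \<le> d" if "j \<le> d" for j
    using degree_prod_linear_le[of "{..d} - {j}"] that by (simp add: lag_def)
  define q where "q = (\<Sum>j\<le>d. smult (poly p (?y j)) (lag j))"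
  have "p = q"
  proof (rule poly_eqI_degree)
    have c: "card (?y ` {..d}) = Suc d"
      by (subst card_image) (auto simp: inj_on_def y_inj)
    show "card (?y ` {..d}) > degree p" using deg c by linarith
    have "degree q \<le> d" unfolding q_def
      by (rule degree_sum_le) (auto intro: deg_lag)
    then show "card (?y ` {..d}) > degree q" using c by linarith
  next
    fix z assume "z \<in> ?y ` {..d}"
    then obtain k where k: "k \<le> d" "z = ?y k" by auto
    have "poly (lag j) z = (if j = k then 1 else 0)" if "j \<le> d" for j
    proof (cases "j = k")
      case True
      then show ?thesis unfolding poly_lag k
        by (simp add: y_inj cong: prod.cong) (rule prod.neutral, use y_inj d in auto)
    next
      case False
      then show ?thesis unfolding poly_lag k using k by (auto intro!: bexI[of _ k])
    qed
    then have "poly q z = (\<Sum>j\<le>d. if j = k then poly p z else 0)"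
      unfolding q_def poly_sum poly_smult by (intro sum.cong refl) (auto simp: k)
    then show "poly p z = poly q z" using k by simp
  qed
  have norm_lag: "norm (poly (lag j) x) \<le> (real d * (norm x + 1)) ^ d / (fact j * fact (d - j))" if j: "j \<le> d" for j
  proof -
    have diff: "norm ((x - ?y i) / (?y j - ?y i)) \<le> (real d * (norm x + 1)) / \<bar>real j - real i\<bar>"
      if i: "i \<in> {..d} - {j}" for i
    proof -
      have "?y j - ?y i = of_real ((real j - real i) / real d)" by (simp add: diff_divide_distrib)
      then have n1: "norm (?y j - ?y i) = \<bar>real j - real i\<bar> / real d"
        by (simp only: norm_of_real) simp
      have "norm (x - ?y i) \<le> norm x + norm (?y i)" by (rule norm_triangle_ineq4)
      also have "norm (?y i) \<le> 1" using i d by (simp add: norm_divide)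
      finally have "norm (x - ?y i) \<le> norm x + 1" by simp
      then have "norm (x - ?y i) * real d \<le> (norm x + 1) * real d" by (rule mult_right_mono) simp
      then show ?thesis unfolding norm_divide n1 by (simp add: divide_right_mono mult.commute)
    qed
    have "norm (poly (lag j) x) = (\<Prod>i\<in>{..d} - {j}. norm ((x - ?y i) / (?y j - ?y i)))"
      by (simp add: poly_lag prod_norm)
    also have "\<dots> \<le> (\<Prod>i\<in>{..d} - {j}. (real d * (norm x + 1)) / \<bar>real j - real i\<bar>)"
      by (rule prod_mono) (use diff in auto)
    also have "\<dots> = (real d * (norm x + 1)) ^ d / (\<Prod>i\<in>{..d} - {j}. \<bar>real j - real i\<bar>)"
      using j by (simp add: prod_dividef)
    also have "(\<Prod>i\<in>{..d} - {j}. \<bar>real j - real i\<bar>) = (\<Prod>i\<in>{..<j}. \<bar>real j - real i\<bar>) * (\<Prod>i\<in>{j<..d}. \<bar>real j - real i\<bar>)"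
      using j by (subst prod.union_disjoint[symmetric]) (auto intro: prod.cong)
    also have "(\<Prod>i\<in>{..<j}. \<bar>real j - real i\<bar>) = (\<Prod>i\<in>{1..j}. real i)"
      by (rule prod.reindex_bij_witness[of _ "\<lambda>i. j - i" "\<lambda>i. j - i"]) (auto simp: of_nat_diff)
    also have "\<dots> = fact j" by (simp add: fact_prod)
    also have "(\<Prod>i\<in>{j<..d}. \<bar>real j - real i\<bar>) = (\<Prod>i\<in>{1..d - j}. real i)"
      by (rule prod.reindex_bij_witness[of _ "\<lambda>i. j + i" "\<lambda>i. i - j"]) (auto simp: of_nat_diff)
    also have "\<dots> = fact (d - j)" by (simp add: fact_prod)
    finally show ?thesis .
  qed
  have "norm (poly p x) = norm (\<Sum>j\<le>d. poly p (?y j) * poly (lag j) x)"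
    by (subst \<open>p = q\<close>) (simp add: q_def poly_sum)
  also have "\<dots> \<le> (\<Sum>j\<le>d. B * ((real d * (norm x + 1)) ^ d / (fact j * fact (d - j))))"
    by (rule sum_norm_le, unfold norm_mult, intro mult_mono bound norm_lag B) auto
  also have "\<dots> = (\<Sum>j\<le>d. B * (real d * (norm x + 1)) ^ d / fact d * real (d choose j))"
    by (rule sum.cong) (auto simp: binomial_fact field_simps)
  also have "\<dots> = B * (real d * (norm x + 1)) ^ d / fact d * real (\<Sum>j\<le>d. d choose j)"
    by (simp add: sum_distrib_left)
  also have "\<dots> = B * (2 * (norm x + 1)) ^ d * (real d ^ d / fact d)"
    by (simp only: choose_row_sum power_mult_distrib of_nat_power of_nat_numeral) simp
  also have "\<dots> \<le> B * (2 * (norm x + 1)) ^ d * 3 ^ d"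
  proof (rule mult_left_mono)
    have "real d ^ d / fact d \<le> exp 1 ^ d" using power_le_exp_fact[of d] by (simp add: field_simps)
    also have "\<dots> \<le> 3 ^ d" using exp_le by (intro power_mono) auto
    finally show "real d ^ d / fact d \<le> 3 ^ d" .
    show "B * (2 * (norm x + 1)) ^ d \<ge> 0" using B by simp
  qed
  also have "\<dots> = B * (6 * (norm x + 1)) ^ d"
    by (simp add: power_mult_distrib[symmetric])
  finally show ?thesis .
qed

section \<open>Multiaffine forms: from the cube to polydiscs\<close>

locale multiaffine =
  fixes I :: "'i set" and c :: "'i \<Rightarrow> complex" and K :: "'i \<Rightarrow> nat set" and d :: nat
  assumes finite_I: "finite I" and finite_K: "a \<in> I \<Longrightarrow> finite (K a)"
    and card_K: "a \<in> I \<Longrightarrow> card (K a) \<le> d" and d_pos: "d > 0"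
begin

definition Q :: "(nat \<Rightarrow> complex) \<Rightarrow> complex" where
  "Q w = (\<Sum>a\<in>I. c a * (\<Prod>i\<in>K a. w i))"

lemma Q_cong: "(\<And>i a. a \<in> I \<Longrightarrow> i \<in> K a \<Longrightarrow> w i = w' i) \<Longrightarrow> Q w = Q w'"
  unfolding Q_def by (intro sum.cong refl arg_cong2[where f = "(*)"] prod.cong) auto

lemma Q_affine_coord:
  "Q w = (1 - w i) * Q (w(i := 0)) + w i * Q (w(i := 1))"
proof -
  have "(\<Prod>j\<in>K a. w j) = (1 - w i) * (\<Prod>j\<in>K a. (w(i := 0)) j) + w i * (\<Prod>j\<in>K a. (w(i := 1)) j)"
    if a: "a \<in> I" for a
  proof (cases "i \<in> K a")
    case True
    have eq: "(\<Prod>j\<in>K a. v j) = v i * (\<Prod>j\<in>K a - {i}. v j)" for v :: "nat \<Rightarrow> complex"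
      using True finite_K[OF a] by (rule prod.remove[rotated])
    have rest: "(\<Prod>j\<in>K a - {i}. (w(i := b)) j) = (\<Prod>j\<in>K a - {i}. w j)" for b by (rule prod.cong) auto
    show ?thesis unfolding eq[of w] eq[of "w(i := 0)"] eq[of "w(i := 1)"] rest by simp
  next
    case False
    have "(\<Prod>j\<in>K a. (w(i := b)) j) = (\<Prod>j\<in>K a. w j)" for b
      using False by (intro prod.cong) auto
    then show ?thesis by (simp add: algebra_simps)
  qed
  then have "Q w = (\<Sum>a\<in>I. c a * ((1 - w i) * (\<Prod>j\<in>K a. (w(i := 0)) j) + w i * (\<Prod>j\<in>K a. (w(i := 1)) j)))"
    unfolding Q_def by (intro sum.cong refl) (simp only:)
  also have "\<dots> = (1 - w i) * Q (w(i := 0)) + w i * Q (w(i := 1))"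
    unfolding Q_def by (simp only: sum_distrib_left sum.distrib[symmetric] distrib_left mult_ac)
  finally show ?thesis .
qed

lemma Q_line_poly: "\<exists>p. degree p \<le> d \<and> (\<forall>x. poly p x = Q (\<lambda>i. u i + x * v i))"
proof -
  define p where "p = (\<Sum>a\<in>I. smult (c a) (\<Prod>i\<in>K a. [:u i, v i:]))"
  have "degree p \<le> d"
    unfolding p_def
  proof (rule degree_sum_le[OF finite_I], rule order_trans[OF degree_smult_le])
    fix a assume a: "a \<in> I"
    show "degree (\<Prod>i\<in>K a. [:u i, v i:]) \<le> d"
      using degree_prod_linear_le[OF finite_K[OF a]] card_K[OF a] order_trans by blast
  qed
  moreover have "poly p x = Q (\<lambda>i. u i + x * v i)" for x
    by (simp add: p_def Q_def poly_sum poly_prod)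
  ultimately show ?thesis by blast
qed

context
  assumes cube: "\<And>y :: nat \<Rightarrow> bool. norm (Q (\<lambda>i. of_bool (y i))) \<le> 1"
begin

text \<open>The form is affine in each coordinate, so letting one coordinate range over [0,1] yields
  convex combinations of values already bounded.\<close>

lemma Q_bound_unit:
  fixes u :: "nat \<Rightarrow> real"
  assumes u: "\<And>i. 0 \<le> u i \<and> u i \<le> 1"
  shows "norm (Q (\<lambda>i. of_real (u i))) \<le> 1"
proof -
  have "norm (Q (\<lambda>i. of_real (u i))) \<le> 1"
    if "finite A" "\<And>i. i \<notin> A \<Longrightarrow> u i = 0 \<or> u i = 1" "\<And>i. 0 \<le> u i \<and> u i \<le> 1" for A u
    using that
  proof (induction A arbitrary: u rule: finite_induct)
    case empty
    then have "of_real (u i) = (of_bool (u i = 1) :: complex)" for i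
      by (metis (full_types) emptyE of_bool_eq of_real_0 of_real_1 zero_neq_one)
    then show ?case using cube[of "\<lambda>i. u i = 1"] by simp
  next
    case (insert j A)
    have upd: "norm (Q ((\<lambda>i. of_real (u i))(j := of_real b))) \<le> 1" if "b = 0 \<or> b = 1" for b
    proof -
      have "norm (Q (\<lambda>i. of_real ((u(j := b)) i))) \<le> 1"
        by (rule insert.IH) (use insert.prems that in auto)
      also have "(\<lambda>i. of_real ((u(j := b)) i)) = (\<lambda>i. of_real (u i))(j := of_real b)" by auto
      finally show ?thesis .
    qed
    have "norm (Q (\<lambda>i. of_real (u i))) \<le> norm (1 - of_real (u j) :: complex) * norm (Q ((\<lambda>i. of_real (u i))(j := 0)))
       + norm (of_real (u j) :: complex) * norm (Q ((\<lambda>i. of_real (u i))(j := 1)))"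
      by (subst Q_affine_coord[of _ j], rule order_trans[OF norm_triangle_ineq]) (simp add: norm_mult)
    also have "\<dots> \<le> norm (1 - of_real (u j) :: complex) * 1 + norm (of_real (u j) :: complex) * 1"
      using upd[of 0] upd[of 1] by (intro add_mono mult_left_mono) auto
    also have "norm (1 - of_real (u j) :: complex) = 1 - u j"
      using insert.prems(2)[of j] by (metis abs_of_nonneg diff_ge_0_iff_ge norm_of_real of_real_1 of_real_diff)
    also have "norm (of_real (u j) :: complex) = u j"
      using insert.prems(2)[of j] by simp
    finally show ?case by simp
  qed
  note * = this
  \<comment> \<open>Only finitely many coordinates occur in the form; the others are set to 0 so
    that the induction applies.\<close>
  define A where "A = (\<Union>a\<in>I. K a)"
  have "norm (Q (\<lambda>i. of_real (if i \<in> A then u i else 0))) \<le> 1"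
    by (rule *[of A]) (use finite_I finite_K u in \<open>auto simp: A_def\<close>)
  also have "Q (\<lambda>i. of_real (if i \<in> A then u i else 0)) = Q (\<lambda>i. of_real (u i))"
    by (rule Q_cong) (auto simp: A_def)
  finally show ?thesis .
qed

text \<open>On the line from the centre (1/2, 1/2, ...) that reaches \<open>u\<close> at parameter
  \<open>Y\<close>, parameters in [0,1] stay in the unit cube; extrapolate to
  \<open>Y\<close>.\<close>

lemma Q_bound_real:
  fixes u :: "nat \<Rightarrow> real"
  assumes u: "\<And>i. \<bar>u i - 1 / 2\<bar> \<le> Y / 2" and Y: "Y > 0"
  shows "norm (Q (\<lambda>i. of_real (u i))) \<le> (6 * (Y + 1)) ^ d"
proof -
  obtain p where p: "degree p \<le> d" "\<And>x. poly p x = Q (\<lambda>i. 1 / 2 + x * of_real ((u i - 1 / 2) / Y))"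
    using Q_line_poly[of "\<lambda>i. 1 / 2" "\<lambda>i. of_real ((u i - 1 / 2) / Y)"] by auto
  have "norm (poly p (of_nat j / of_nat d)) \<le> 1" if j: "j \<le> d" for j
  proof -
    define s where "s = real j / real d"
    have s: "0 \<le> s" "s \<le> 1" using j by (auto simp: s_def divide_le_eq)
    have b: "\<bar>s * ((u i - 1 / 2) / Y)\<bar> \<le> 1 / 2" for i
    proof -
      have "\<bar>(u i - 1 / 2) / Y\<bar> \<le> 1 / 2" using u[of i] Y by (simp add: abs_divide field_simps)
      then have "s * \<bar>(u i - 1 / 2) / Y\<bar> \<le> 1 * (1 / 2)" using s by (intro mult_mono) auto
      then show ?thesis using s by (simp add: abs_mult)
    qed
    have "poly p (of_nat j / of_nat d) = Q (\<lambda>i. of_real (1 / 2 + s * ((u i - 1 / 2) / Y)))"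
      by (simp add: p(2) s_def)
    moreover have "0 \<le> 1 / 2 + s * ((u i - 1 / 2) / Y) \<and> 1 / 2 + s * ((u i - 1 / 2) / Y) \<le> 1" for i
      using b[of i] unfolding abs_le_iff by linarith
    ultimately show ?thesis using Q_bound_unit[of "\<lambda>i. 1 / 2 + s * ((u i - 1 / 2) / Y)"] by metis
  qed
  then have "norm (poly p (of_real Y)) \<le> 1 * (6 * (norm (of_real Y :: complex) + 1)) ^ d"
    by (intro lagrange_extrapolation p d_pos)
  moreover have "poly p (of_real Y) = Q (\<lambda>i. of_real (u i))"
    using Y by (simp add: p(2))
  ultimately show ?thesis using Y by simp
qed

text \<open>Extrapolates a second time, from the real points \<open>Re w + x Im w\<close> with \<open>0 \<le> x \<le> 1\<close>
  to \<open>x = \<i>\<close>.\<close>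

lemma Q_bound_complex:
  assumes w: "\<And>i. norm (w i) \<le> X" and X: "X \<ge> 1"
  shows "norm (Q w) \<le> (432 * X) ^ d"
proof -
  obtain p where p: "degree p \<le> d" "\<And>x. poly p x = Q (\<lambda>i. of_real (Re (w i)) + x * of_real (Im (w i)))"
    using Q_line_poly[of "\<lambda>i. of_real (Re (w i))" "\<lambda>i. of_real (Im (w i))"] by auto
  have "norm (poly p (of_nat j / of_nat d)) \<le> (6 * (5 * X + 1)) ^ d" if j: "j \<le> d" for j
  proof -
    define s where "s = real j / real d"
    have s: "0 \<le> s" "s \<le> 1" using j by (auto simp: s_def divide_le_eq)
    \<comment> \<open>As \<open>X \<ge> 1\<close>, the crude bound 2X + 1/2 is at most 5X/2, so
      \<open>Q_bound_real\<close> applies with Y = 5X.\<close>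
    have "\<bar>Re (w i) + s * Im (w i) - 1 / 2\<bar> \<le> 5 * X / 2" for i
    proof -
      have "\<bar>Re (w i)\<bar> \<le> X" using abs_Re_le_cmod[of "w i"] w[of i] by linarith
      moreover have "\<bar>s * Im (w i)\<bar> \<le> 1 * X"
        using abs_Im_le_cmod[of "w i"] w[of i] s unfolding abs_mult by (intro mult_mono) auto
      ultimately show ?thesis using X by linarith
    qed
    then have "norm (Q (\<lambda>i. of_real (Re (w i) + s * Im (w i)))) \<le> (6 * (5 * X + 1)) ^ d"
      using X by (intro Q_bound_real) auto
    then show ?thesis by (simp add: p(2) s_def)
  qed
  then have "norm (poly p \<i>) \<le> (6 * (5 * X + 1)) ^ d * (6 * (norm \<i> + 1)) ^ d"
    by (intro lagrange_extrapolation p d_pos)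
  also have "poly p \<i> = Q w" by (simp add: p(2) complex_eq[symmetric])
  also have "(6 * (5 * X + 1)) ^ d * (6 * (norm \<i> + 1)) ^ d = (72 * (5 * X + 1)) ^ d"
    by (simp add: power_mult_distrib[symmetric])
  also have "\<dots> \<le> (432 * X) ^ d" using X by (intro power_mono) auto
  finally show ?thesis .
qed

end

end

text \<open>Cauchy's inequality for the \<open>k\<close>-th derivative at 0, divided by
  \<open>fact k\<close>.\<close>

lemma norm_coeff_le:
  fixes p :: "complex poly"
  assumes "r > 0" "\<And>s. norm s = r \<Longrightarrow> norm (poly p s) \<le> B"
  shows "norm (coeff p k) \<le> B / r ^ k"
proof -
  have deriv: "(deriv ^^ k) (poly p) = poly ((pderiv ^^ k) p)" for k
  proof (induction k)
    case (Suc k)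
    have "deriv (poly q) = poly (pderiv q)" for q :: "complex poly"
      using poly_DERIV by (auto simp: fun_eq_iff intro!: DERIV_imp_deriv)
    then show ?case using Suc by simp
  qed simp
  have "norm ((deriv ^^ k) (poly p) 0) \<le> fact k * B / r ^ k"
    by (rule Cauchy_inequality) (use assms in \<open>auto intro!: holomorphic_intros continuous_intros\<close>)
  moreover have "(deriv ^^ k) (poly p) 0 = fact k * coeff p k"
    by (simp add: deriv poly_0_coeff_0 coeff_higher_pderiv pochhammer_fact)
  ultimately have "fact k * norm (coeff p k) \<le> fact k * (B / r ^ k)" by (simp add: norm_mult)
  then show ?thesis by (rule mult_left_le_imp_le) simp
qed

section \<open>Polynomials with coefficients of low Fourier degree\<close>

text \<open>Degree budget: \<open>L\<close> for each of \<open>a\<close> factors and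
  \<open>L\<close> for each power of the variable, with nothing asked beyond power
  \<open>m\<close>.\<close>

definition graded :: "'v set \<Rightarrow> nat \<Rightarrow> nat \<Rightarrow> nat \<Rightarrow> ('v set \<Rightarrow> complex poly) \<Rightarrow> bool" where
  "graded V L m a P \<longleftrightarrow> (\<forall>k\<le>m. lowdeg V ((a + k) * L) (\<lambda>Z. coeff (P Z) k))"

lemma graded_mono: "graded V L m a P \<Longrightarrow> a \<le> a' \<Longrightarrow> graded V L m a' P"
  unfolding graded_def by (meson add_le_mono1 lowdeg_mono mult_le_mono1)

lemma graded_const: "graded V L m a (\<lambda>Z. p)"
  by (simp add: graded_def lowdeg_const)

lemma graded_sum:
  "(\<And>x. x \<in> A \<Longrightarrow> graded V L m a (P x)) \<Longrightarrow> graded V L m a (\<lambda>Z. \<Sum>x\<in>A. P x Z)"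
  by (simp add: graded_def coeff_sum lowdeg_sum)

lemma graded_add: "graded V L m a P \<Longrightarrow> graded V L m a P' \<Longrightarrow> graded V L m a (\<lambda>Z. P Z + P' Z)"
  by (simp add: graded_def lowdeg_add)

lemma graded_smult: "finite V \<Longrightarrow> graded V L m a P \<Longrightarrow> graded V L m a (\<lambda>Z. smult c (P Z))"
  by (simp add: graded_def lowdeg_cmult)

text \<open>Coefficient \<open>k\<close> of a product uses only coefficients up to \<open>k\<close>,
  so the cutoff \<open>m\<close> survives and the budgets add.\<close>

lemma graded_mult:
  assumes "finite V" "graded V L m a P" "graded V L m b P'"
  shows "graded V L m (a + b) (\<lambda>Z. P Z * P' Z)"
  unfolding graded_def coeff_mult
proof (intro allI impI lowdeg_sum)
  fix k i assume k: "k \<le> m" and i: "i \<in> {..k}"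
  have "lowdeg V ((a + i) * L + (b + (k - i)) * L) (\<lambda>Z. coeff (P Z) i * coeff (P' Z) (k - i))"
    by (rule lowdeg_mult[OF assms(1)]; rule assms(2,3)[unfolded graded_def, rule_format])
       (use k i in auto)
  moreover have "(a + i) * L + (b + (k - i)) * L = (a + b + k) * L"
    using i by (simp add: add_mult_distrib[symmetric])
  ultimately show "lowdeg V ((a + b + k) * L) (\<lambda>Z. coeff (P Z) i * coeff (P' Z) (k - i))" by simp
qed

lemma graded_prod:
  assumes "finite V" "finite A" "\<And>i. i \<in> A \<Longrightarrow> graded V L m 1 (P i)"
  shows "graded V L m (card A) (\<lambda>Z. \<Prod>i\<in>A. P i Z)"
  using assms(2,3)
proof (induction A rule: finite_induct)
  case (insert x A)
  then show ?case using graded_mult[OF assms(1), of L m 1 "P x" "card A"] by simp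
qed (simp add: graded_const)

section \<open>Interpolation from an approximate to an exact test\<close>

text \<open>The last coefficient makes the value at 1 exact; its Fourier degree is unbounded, which is harmless
  because only the coefficients up to \<open>m\<close> have to be of low degree.\<close>

definition step_coeff :: "nat \<Rightarrow> real \<Rightarrow> nat \<Rightarrow> real" where
  "step_coeff m q k = (if k = 0 then q else if k \<le> m then q ^ (k + 1) - q ^ k
     else of_bool (q = 1) - q ^ (m + 1))"

definition step_poly :: "nat \<Rightarrow> real \<Rightarrow> complex poly" where
  "step_poly m q = (\<Sum>k\<le>m + 1. monom (of_real (step_coeff m q k)) k)"

lemma coeff_step_poly: "k \<le> m \<Longrightarrow> coeff (step_poly m q) k = of_real (step_coeff m q k)"
  by (simp add: step_poly_def coeff_sum)

text \<open>The coefficients up to \<open>j\<close> telescope to \<open>q ^ (j + 1)\<close>; the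
  last one replaces \<open>q ^ (m + 1)\<close> by the indicator.\<close>

lemma poly_step_poly_1: "poly (step_poly m q) 1 = of_bool (q = 1)"
proof -
  have "(\<Sum>k\<le>j. step_coeff m q k) = q ^ (j + 1)" if "j \<le> m" for j
    using that by (induction j) (auto simp: step_coeff_def)
  then have "(\<Sum>k\<le>m + 1. step_coeff m q k) = of_bool (q = 1)"
    by (simp add: step_coeff_def)
  moreover have "poly (step_poly m q) 1 = of_real (\<Sum>k\<le>m + 1. step_coeff m q k)"
    by (simp add: step_poly_def poly_sum poly_monom)
  ultimately show ?thesis by simp
qed

text \<open>For \<open>q = 1\<close> only the constant coefficient survives. Otherwise coefficient
  \<open>k\<close> is at most \<open>q ^ k\<close>, and a geometric series of ratio 1/2
  dominates.\<close>

lemma norm_poly_step_poly_le: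
  assumes q: "0 \<le> q" "q \<le> 1" and s: "norm s \<le> r" and qr: "q = 1 \<or> q * r \<le> 1 / 2"
  shows "norm (poly (step_poly m q) s) \<le> 2"
proof (cases "q = 1")
  case True
  have "poly (step_poly m q) s = (\<Sum>k\<le>m + 1. if k = 0 then 1 else 0)"
    unfolding True step_poly_def poly_sum poly_monom
    by (intro sum.cong refl) (simp add: step_coeff_def)
  then show ?thesis by (simp del: sum.atMost_Suc)
next
  case False
  then have qr: "q * r \<le> 1 / 2" using assms by simp
  have r: "r \<ge> 0" using s norm_ge_zero order_trans by blast
  have coeff: "\<bar>step_coeff m q k\<bar> \<le> q ^ k" if "k \<le> m + 1" for k
  proof -
    have "q ^ Suc k \<le> q ^ k" using q by (intro power_decreasing) auto
    moreover have "0 \<le> q ^ Suc k" using q by simp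
    moreover have "k = m + 1" if "k \<noteq> 0" "\<not> k \<le> m" using that \<open>k \<le> m + 1\<close> by simp
    ultimately show ?thesis using False q by (auto simp: step_coeff_def)
  qed
  have "norm (poly (step_poly m q) s) \<le> (\<Sum>k\<le>m + 1. (1 / 2) ^ k)"
    unfolding step_poly_def poly_sum poly_monom
  proof (rule sum_norm_le)
    fix k assume k: "k \<in> {..m + 1}"
    have "norm (of_real (step_coeff m q k) * s ^ k) = \<bar>step_coeff m q k\<bar> * norm s ^ k"
      by (simp add: norm_mult norm_power)
    also have "\<dots> \<le> q ^ k * r ^ k"
      using k s r q by (intro mult_mono coeff power_mono) auto
    also have "\<dots> \<le> (1 / 2) ^ k"
      using qr q r by (simp only: power_mult_distrib[symmetric]) (intro power_mono, auto)
    finally show "norm (of_real (step_coeff m q k) * s ^ k) \<le> (1 / 2) ^ k" .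
  qed
  also have "\<dots> = 2 - (1 / 2) ^ (m + 1)"
  proof -
    have "(\<Sum>k\<le>n. (1 / 2) ^ k) = 2 - (1 / 2 :: real) ^ n" for n by (induction n) auto
    then show ?thesis .
  qed
  also have "\<dots> \<le> 2" by simp
  finally show ?thesis .
qed

lemma graded_step_poly:
  assumes V: "finite V" and q: "lowdeg V L (\<lambda>Z. of_real (q Z))"
  shows "graded V L m 1 (\<lambda>Z. step_poly m (q Z))"
  unfolding graded_def
proof (intro allI impI)
  fix k assume k: "k \<le> m"
  have pow: "lowdeg V (j * L) (\<lambda>Z. of_real (q Z ^ j))" for j
    using lowdeg_power[OF V q, of j] by simp
  show "lowdeg V ((1 + k) * L) (\<lambda>Z. coeff (step_poly m (q Z)) k)"
  proof (cases "k = 0")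
    case True
    then show ?thesis using q by (simp add: coeff_step_poly step_coeff_def)
  next
    case False
    have "lowdeg V ((1 + k) * L) (\<lambda>Z. of_real (q Z ^ (k + 1)) + (- 1) * of_real (q Z ^ k))"
      by (intro lowdeg_add lowdeg_cmult[OF V])
         (use pow[of "k + 1"] lowdeg_mono[OF pow[of k]] in auto)
    then show ?thesis using False k by (simp add: coeff_step_poly step_coeff_def)
  qed
qed

section \<open>Comparisons as sums of suffix tests\<close>

lemma set_encode_less_power: "X \<subseteq> {..<j} \<Longrightarrow> set_encode X < 2 ^ j"
proof -
  assume "X \<subseteq> {..<j}"
  then have "set_encode X \<le> (\<Sum>i\<in>{..<j}. 2 ^ i)"
    unfolding set_encode_def by (intro sum_mono2) auto
  also have "\<dots> < (2::nat) ^ j" by (induction j) auto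
  finally show ?thesis .
qed

lemma set_encode_less_suffix:
  assumes "finite X" "finite U" "j \<in> U" and suf: "X \<inter> {j..} = (U - {j}) \<inter> {j..}"
  shows "set_encode X < set_encode U"
proof -
  have X: "set_encode X = set_encode (X \<inter> {j..}) + set_encode (X \<inter> {..<j})"
    unfolding set_encode_def using assms(1)
    by (subst sum.union_disjoint[symmetric]) (auto intro!: sum.cong)
  have suf: "i \<in> X \<longleftrightarrow> i \<in> U \<and> i \<noteq> j" if "i \<ge> j" for i
    using suf that unfolding set_eq_iff by (metis DiffD1 DiffD2 DiffI IntD1 IntI atLeast_iff singleton_iff)
  have "set_encode (X \<inter> {..<j}) < 2 ^ j" by (rule set_encode_less_power) auto
  moreover have "set_encode (insert j (X \<inter> {j..})) = 2 ^ j + set_encode (X \<inter> {j..})"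
    using assms(1) suf[of j] by (intro set_encode_insert) auto
  moreover have "set_encode (insert j (X \<inter> {j..})) \<le> set_encode U"
    unfolding set_encode_def using assms(2,3) suf by (intro sum_mono2) auto
  ultimately show ?thesis using X by linarith
qed

text \<open>The highest digit in which the two sets differ decides the comparison.\<close>

lemma set_encode_less_iff_suffix:
  assumes "finite X" "finite U"
  shows "set_encode X < set_encode U \<longleftrightarrow> (\<exists>j\<in>U. X \<inter> {j..} = (U - {j}) \<inter> {j..})"
proof
  assume less: "set_encode X < set_encode U"
  define j where "j = Max (sym_diff X U)"
  have "sym_diff X U \<noteq> {}" using less by auto
  then have j: "j \<in> sym_diff X U" unfolding j_def using assms by (intro Max_in) auto
  have max: "i \<in> X \<longleftrightarrow> i \<in> U" if "i > j" for i
  proof (rule ccontr)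
    assume "\<not> ?thesis"
    then have "i \<in> sym_diff X U" by auto
    then have "i \<le> j" unfolding j_def using assms by (intro Max_ge) auto
    then show False using that by simp
  qed
  have ge: "i = j \<or> i > j" if "i \<ge> j" for i using that by auto
  show "\<exists>j\<in>U. X \<inter> {j..} = (U - {j}) \<inter> {j..}"
  proof (cases "j \<in> U")
    case True
    then have "X \<inter> {j..} = (U - {j}) \<inter> {j..}" using j max by (auto dest: ge)
    then show ?thesis using True by blast
  next
    case False
    then have "U \<inter> {j..} = (X - {j}) \<inter> {j..}" "j \<in> X" using j max by (auto dest: ge)
    then show ?thesis using set_encode_less_suffix[OF assms(2,1)] less by force
  qed
next
  assume "\<exists>j\<in>U. X \<inter> {j..} = (U - {j}) \<inter> {j..}"
  then show "set_encode X < set_encode U" using set_encode_less_suffix[OF assms] by blast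
qed

text \<open>Successes at i < j would exclude each other: the first makes digit j agree, the second
  makes it differ. Hence the disjunction is a plain sum.\<close>

lemma of_bool_set_encode_less:
  assumes "finite X" "finite U"
  shows "(of_bool (set_encode X < set_encode U) :: complex) =
    (\<Sum>j\<in>U. of_bool (X \<inter> {j..} = (U - {j}) \<inter> {j..}))"
proof (cases "set_encode X < set_encode U")
  case False
  then show ?thesis by (simp add: set_encode_less_iff_suffix[OF assms])
next
  case True
  then obtain j where j: "j \<in> U" "X \<inter> {j..} = (U - {j}) \<inter> {j..}"
    by (auto simp: set_encode_less_iff_suffix[OF assms])
  have mem: "l \<in> X \<longleftrightarrow> l \<in> U \<and> l \<noteq> i" if "X \<inter> {i..} = (U - {i}) \<inter> {i..}" "l \<ge> i" for i l
    using that unfolding set_eq_iff by (metis DiffD1 DiffD2 DiffI IntD1 IntI atLeast_iff singleton_iff)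
  have "\<not> (X \<inter> {i..} = (U - {i}) \<inter> {i..})" if "i \<in> U" "i \<noteq> j" for i
    using mem[of i i] mem[of i j] mem[OF j(2), of i] mem[OF j(2), of j] j(1) that
    by (metis linorder_linear)
  then have "(\<Sum>i\<in>U. of_bool (X \<inter> {i..} = (U - {i}) \<inter> {i..})) = (\<Sum>i\<in>U. if i = j then 1 else (0::complex))"
    using j(2) by (intro sum.cong refl) (metis of_bool_eq(1,2))
  then show ?thesis using True j(1) assms by simp
qed

section \<open>Approximate suffix tests\<close>

text \<open>\<open>b\<close> will be the last digit of the encoding and is left arbitrary here, to
  be chosen once the parity is known.\<close>

locale suffix_tests =
  fixes M :: nat and A :: "nat \<Rightarrow> nat set" and L m :: nat and b :: "nat set \<Rightarrow> bool"
  assumes M_pos: "M > 0" and A_sub: "A r \<subseteq> {..<M}"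
    and A_bias: "D \<subseteq> {..<M} \<Longrightarrow> D \<noteq> {} \<Longrightarrow> (\<Sum>r<6 * M. chi (A r) D) \<le> 3 * M"
begin

definition V :: "(nat \<times> nat) set" where
  "V = {..<M} \<times> {..<6 * M}"

definition lift :: "nat set \<Rightarrow> (nat \<times> nat) set" where
  "lift = lift_set V (\<lambda>(j, r). A r \<inter> {j..})"

text \<open>The mean agreement of the signs at \<open>j\<close> with those prescribed by the suffix
  of \<open>J\<close>, moved from [-1,1] to [0,1]; the power \<open>L\<close> amplifies the
  gap.\<close>

definition test :: "nat \<Rightarrow> nat set \<Rightarrow> (nat \<times> nat) set \<Rightarrow> real" where
  "test j J Z = ((1 + (\<Sum>r<6 * M. chi {(j, r)} Z * chi (A r) (J \<inter> {j..})) / (6 * M)) / 2) ^ L"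

lemma finite_V [simp]: "finite V"
  by (simp add: V_def)

lemma card_V: "card V = 6 * M ^ 2"
  by (simp add: V_def card_cartesian_product power2_eq_square)

lemma abs_sum_chi_le: "\<bar>\<Sum>r<6 * M. chi (F r) Z * chi (G r) Y\<bar> \<le> 6 * M"
proof -
  have "\<bar>\<Sum>r<6 * M. chi (F r) Z * chi (G r) Y\<bar> \<le> (\<Sum>r<6 * M. 1)"
    by (rule sum_abs[THEN order_trans]) (simp add: abs_mult)
  then show ?thesis by simp
qed

lemma test_base_bounds:
  "0 \<le> (1 + (\<Sum>r<6 * M. chi {(j, r)} Z * chi (A r) (J \<inter> {j..})) / (6 * M)) / 2"
  "(1 + (\<Sum>r<6 * M. chi {(j, r)} Z * chi (A r) (J \<inter> {j..})) / (6 * M)) / 2 \<le> 1"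
  using abs_sum_chi_le[of "\<lambda>r. {(j, r)}" Z A "J \<inter> {j..}"] M_pos
  by (auto simp: field_simps abs_le_iff)

lemma test_nonneg: "0 \<le> test j J Z" and test_le_1: "test j J Z \<le> 1"
  unfolding test_def using test_base_bounds by (auto intro: zero_le_power power_le_one)

lemma lowdeg_test:
  assumes "j < M"
  shows "lowdeg V L (\<lambda>Z. of_real (test j J Z))"
proof -
  let ?c = "\<lambda>r. of_real (chi (A r) (J \<inter> {j..}) / (6 * M) / 2) :: complex"
  have "lowdeg V 1 (\<lambda>Z. 1 / 2 + (\<Sum>r<6 * M. ?c r * of_real (chi {(j, r)} Z)))"
    by (intro lowdeg_add lowdeg_const lowdeg_sum lowdeg_chi) (use assms in \<open>auto simp: V_def\<close>)
  from lowdeg_power[OF finite_V this, of L]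
  have "lowdeg V L (\<lambda>Z. (1 / 2 + (\<Sum>r<6 * M. ?c r * of_real (chi {(j, r)} Z))) ^ L)" by simp
  moreover have "(1 / 2 + (\<Sum>r<6 * M. ?c r * of_real (chi {(j, r)} Z))) ^ L = of_real (test j J Z)" for Z
  proof -
    have "1 / 2 + (\<Sum>r<6 * M. ?c r * of_real (chi {(j, r)} Z)) =
      of_real (1 / 2 + (\<Sum>r<6 * M. chi (A r) (J \<inter> {j..}) / (6 * M) / 2 * chi {(j, r)} Z))"
      by simp
    also have "1 / 2 + (\<Sum>r<6 * M. chi (A r) (J \<inter> {j..}) / (6 * M) / 2 * chi {(j, r)} Z)
      = (1 + (\<Sum>r<6 * M. chi {(j, r)} Z * chi (A r) (J \<inter> {j..})) / (6 * M)) / 2"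
      by (simp add: sum_divide_distrib add_divide_distrib mult.commute)
    finally show ?thesis by (simp only: test_def of_real_power)
  qed
  ultimately show ?thesis by simp
qed

text \<open>On a lift, the products become \<open>chi (A r)\<close> of the difference of the
  suffixes. Their mean is 1 if the suffixes agree and at most 1/2 otherwise, so the base is 1 or at
  most 3/4.\<close>

lemma test_lift:
  assumes "j < M" "X \<subseteq> {..<M}" "J \<subseteq> {..<M}"
  shows "X \<inter> {j..} = J \<inter> {j..} \<Longrightarrow> test j J (lift X) = 1"
    and "X \<inter> {j..} \<noteq> J \<inter> {j..} \<Longrightarrow> test j J (lift X) \<le> (3 / 4) ^ L"
proof -
  let ?D = "sym_diff (X \<inter> {j..}) (J \<inter> {j..})"
  have fin: "finite (X \<inter> {j..})" "finite (J \<inter> {j..})" using assms finite_subset by blast+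
  have "chi {(j, r)} (lift X) * chi (A r) (J \<inter> {j..}) = chi (A r) ?D" if "r < 6 * M" for r
  proof -
    have "chi {(j, r)} (lift X) = chi (A r \<inter> {j..}) X"
      unfolding lift_def by (subst chi_singleton_lift_set) (use assms that in \<open>auto simp: V_def\<close>)
    then show ?thesis
      using chi_sym_diff[OF fin, of "A r"] by (simp only: chi_Int_shift chi_commute[of "A r"])
  qed
  then have sum: "(\<Sum>r<6 * M. chi {(j, r)} (lift X) * chi (A r) (J \<inter> {j..})) = (\<Sum>r<6 * M. chi (A r) ?D)"
    by simp
  show "test j J (lift X) = 1" if "X \<inter> {j..} = J \<inter> {j..}"
    unfolding test_def sum using that M_pos by simp
  show "test j J (lift X) \<le> (3 / 4) ^ L" if "X \<inter> {j..} \<noteq> J \<inter> {j..}"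
  proof -
    have "(\<Sum>r<6 * M. chi (A r) ?D) \<le> 3 * M"
      by (rule A_bias) (use assms that in auto)
    then have "(1 + (\<Sum>r<6 * M. chi (A r) ?D) / (6 * M)) / 2 \<le> 3 / 4"
      using M_pos by (simp add: field_simps)
    then show ?thesis
      using power_mono[of _ "3/4 :: real" L] test_base_bounds(1)[of j "lift X" J]
      unfolding test_def sum by blast
  qed
qed

text \<open>Cutting at \<open>M\<close> makes the norm bounds on \<open>\<xi> i\<close> hold for
  every \<open>i\<close>, as the polydisc estimate requires.\<close>

definition prefix_set :: "nat \<Rightarrow> nat set" where
  "prefix_set i = set_decode (i div 2) \<inter> {..<M}"

text \<open>A model of \<open>encode X \<le> i\<close>: the sum covers a smaller prefix, the last
  term a tie, where \<open>b X\<close> equals \<open>b (prefix_set i)\<close>.\<close>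

definition \<xi> :: "nat \<Rightarrow> (nat \<times> nat) set \<Rightarrow> complex poly" where
  "\<xi> i Z = (\<Sum>j<M. smult (of_bool (j \<in> prefix_set i)) (step_poly m (test j (prefix_set i - {j}) Z)))
     + smult (of_bool (odd i \<or> \<not> b (prefix_set i))) (step_poly m (test 0 (prefix_set i) Z))"

definition encode :: "nat set \<Rightarrow> nat" where
  "encode X = 2 * set_encode X + of_bool (b X)"

lemma graded_\<xi>: "graded V L m 1 (\<xi> i)"
  unfolding \<xi>_def
  by (intro graded_add graded_sum graded_smult finite_V graded_step_poly lowdeg_test) (use M_pos in auto)

lemma norm_poly_\<xi>_le:
  assumes "\<And>j J. j < M \<Longrightarrow> J \<subseteq> {..<M} \<Longrightarrow> test j J Z = 1 \<or> test j J Z * r \<le> 1 / 2" "norm s \<le> r"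
  shows "norm (poly (\<xi> i Z) s) \<le> 2 * (M + 1)"
proof -
  have step: "norm (of_bool P * poly (step_poly m (test j J Z)) s) \<le> 2"
    if "j < M" "J \<subseteq> {..<M}" for P j J
    using norm_poly_step_poly_le[OF test_nonneg test_le_1 assms(2) assms(1)[OF that], of m]
    by (cases P) auto
  have "norm (poly (\<xi> i Z) s) \<le> (\<Sum>j<M. 2) + 2"
    unfolding \<xi>_def poly_add poly_sum poly_smult
    by (intro order_trans[OF norm_triangle_ineq] add_mono sum_norm_le step)
       (use M_pos in \<open>auto simp: prefix_set_def\<close>)
  then show ?thesis by simp
qed

text \<open>Radius 1/2 works at every sign vector, lift or not, because \<open>test\<close> never
  exceeds 1.\<close>

lemma norm_poly_\<xi>_le_half: "norm s \<le> 1 / 2 \<Longrightarrow> norm (poly (\<xi> i Z) s) \<le> 2 * (M + 1)"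
  by (rule norm_poly_\<xi>_le[of _ "1 / 2"]) (use test_le_1 in auto)

text \<open>On a lift a failed test is at most \<open>(3 / 4) ^ L\<close>, which permits the larger
  radius.\<close>

lemma norm_poly_\<xi>_lift_le:
  assumes "X \<subseteq> {..<M}" "norm s \<le> (4 / 3) ^ L / 2"
  shows "norm (poly (\<xi> i (lift X)) s) \<le> 2 * (M + 1)"
proof (rule norm_poly_\<xi>_le[OF _ assms(2)])
  fix j J assume j: "j < M" "J \<subseteq> {..<M}"
  show "test j J (lift X) = 1 \<or> test j J (lift X) * ((4 / 3) ^ L / 2) \<le> 1 / 2"
  proof (cases "X \<inter> {j..} = J \<inter> {j..}")
    case True
    then show ?thesis using test_lift(1)[OF j(1) assms(1) j(2)] by simp
  next
    case False
    then have "test j J (lift X) * ((4 / 3) ^ L / 2) \<le> (3 / 4) ^ L * ((4 / 3) ^ L / 2)"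
      using test_lift(2)[OF j(1) assms(1) j(2)] by (intro mult_right_mono) auto
    also have "\<dots> = 1 / 2" by (simp add: power_mult_distrib[symmetric])
    finally show ?thesis by simp
  qed
qed

lemma poly_\<xi>_lift_1:
  assumes L: "L > 0" and X: "X \<subseteq> {..<M}" and i: "i < 2 ^ (M + 1)"
  shows "poly (\<xi> i (lift X)) 1 = of_bool (encode X \<le> i)"
proof -
  define U where "U = set_decode (i div 2)"
  have enc: "set_encode U = i div 2" by (simp add: U_def)
  have "U \<subseteq> {..<M}"
  proof
    fix j assume "j \<in> U"
    then have "2 ^ j \<le> set_encode U"
      unfolding set_encode_def by (intro member_le_sum) (auto simp: U_def)
    also have "\<dots> < 2 ^ M" using i enc by simp
    finally show "j \<in> {..<M}" by simp
  qed
  then have U: "prefix_set i = U" "U \<subseteq> {..<M}" "finite U" "finite X"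
    using X finite_subset by (auto simp: prefix_set_def U_def)
  have exact: "poly (step_poly m (test j J (lift X))) 1 = of_bool (X \<inter> {j..} = J \<inter> {j..})"
    if j: "j < M" "J \<subseteq> {..<M}" for j J
  proof -
    \<comment> \<open>\<open>L > 0\<close> keeps failed tests strictly below 1, so the indicator
      \<open>q = 1\<close> inside \<open>step_poly\<close> is the exact test.\<close>
    have "(3 / 4 :: real) ^ L < 1" using L by (simp add: power_less_one_iff)
    then have "test j J (lift X) = 1 \<longleftrightarrow> X \<inter> {j..} = J \<inter> {j..}"
      using test_lift[OF j(1) X j(2)] by (metis not_le)
    then show ?thesis by (simp add: poly_step_poly_1)
  qed
  have "poly (\<xi> i (lift X)) 1 = (\<Sum>j<M. of_bool (j \<in> U) * of_bool (X \<inter> {j..} = (U - {j}) \<inter> {j..}))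
     + of_bool (odd i \<or> \<not> b U) * of_bool (X = U)"
  proof -
    have "U - {j} \<subseteq> {..<M}" for j using U(2) by auto
    moreover have "X \<inter> {0..} = U \<inter> {0..} \<longleftrightarrow> X = U" by (simp add: atLeast_0)
    ultimately show ?thesis
      unfolding \<xi>_def poly_add poly_sum poly_smult U(1) using U(2) M_pos by (simp add: exact)
  qed
  also have "(\<Sum>j<M. of_bool (j \<in> U) * of_bool (X \<inter> {j..} = (U - {j}) \<inter> {j..}))
      = (\<Sum>j\<in>U. of_bool (X \<inter> {j..} = (U - {j}) \<inter> {j..}) :: complex)"
    using U(2) by (intro sum.mono_neutral_cong_right) auto
  also have "\<dots> = of_bool (set_encode X < set_encode U)"
    by (rule of_bool_set_encode_less[symmetric]) (use U in auto)
  also have "\<dots> + of_bool (odd i \<or> \<not> b U) * of_bool (X = U) = of_bool (encode X \<le> i)"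
  proof -
    have eq: "X = U \<longleftrightarrow> set_encode X = i div 2" using set_encode_eq[OF U(4,3)] enc by simp
    show ?thesis
    proof (cases "X = U")
      case True
      then show ?thesis using enc by (cases "b U"; cases "odd i") (auto simp: encode_def elim!: oddE evenE)
    next
      case False
      then show ?thesis using eq enc by (auto simp: encode_def of_bool_def)
    qed
  qed
  finally show ?thesis .
qed

end

section \<open>Correlation with the bent function\<close>

lemma sum_power_tail_le:
  fixes x :: real
  assumes "0 \<le> x" "x \<le> 1 / 2"
  shows "(\<Sum>k\<in>{m<..n}. x ^ k) \<le> x ^ m"
proof -
  have "(\<Sum>k\<in>{m<..m + j}. x ^ k) \<le> x ^ m - x ^ (m + j)" for j
  proof (induction j)
    case (Suc j)
    have "x ^ (m + j) * (2 * x) \<le> x ^ (m + j) * 1"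
      using assms by (intro mult_left_mono) auto
    moreover have "{m<..m + Suc j} = insert (m + Suc j) {m<..m + j}" by auto
    ultimately show ?case using Suc by (simp add: algebra_simps)
  qed simp
  from this[of "n - m"] show ?thesis
    using assms by (cases "m \<le> n") (auto intro: order_trans)
qed

locale interpolated = multiaffine I c K d + suffix_tests M A L m b
  for I :: "'i set" and c :: "'i \<Rightarrow> complex" and K :: "'i \<Rightarrow> nat set" and d :: nat
    and M :: nat and A :: "nat \<Rightarrow> nat set" and L m :: nat and b :: "nat set \<Rightarrow> bool" +
  assumes cube: "norm (Q (\<lambda>i. of_bool (y i))) \<le> 1"
    and K_sub: "a \<in> I \<Longrightarrow> K a \<subseteq> {..<2 ^ (M + 1)}"
    and L_ge: "(4 / 3) ^ L / 2 \<ge> (2 :: real)"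
begin

definition h :: "(nat \<times> nat) set \<Rightarrow> complex poly" where
  "h Z = (\<Sum>a\<in>I. smult (c a) (\<Prod>i\<in>K a. \<xi> i Z))"

text \<open>The bound of \<open>Q_bound_complex\<close> at radius \<open>2 * (M + 1)\<close>, with
  864 = 432 * 2.\<close>

definition growth :: real where
  "growth = (864 * (M + 1)) ^ d"

lemma poly_h: "poly (h Z) s = Q (\<lambda>i. poly (\<xi> i Z) s)"
  by (simp add: h_def Q_def poly_sum poly_prod)

lemma growth_nonneg: "growth \<ge> 0"
  by (simp add: growth_def)

lemma graded_h: "graded V L m d h"
  unfolding h_def
proof (intro graded_sum graded_smult finite_V)
  fix a assume a: "a \<in> I"
  show "graded V L m d (\<lambda>Z. \<Prod>i\<in>K a. \<xi> i Z)"
    by (rule graded_mono[OF graded_prod[OF finite_V finite_K[OF a] graded_\<xi>] card_K[OF a]])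
qed

lemma norm_coeff_h_le:
  assumes "r > 0" "\<And>i s. norm s \<le> r \<Longrightarrow> norm (poly (\<xi> i Z) s) \<le> 2 * (M + 1)"
  shows "norm (coeff (h Z) k) \<le> growth / r ^ k"
proof (rule norm_coeff_le[OF assms(1)])
  fix s :: complex assume "norm s = r"
  then have "norm (poly (h Z) s) \<le> (432 * real (2 * (M + 1))) ^ d"
    unfolding poly_h using assms by (intro Q_bound_complex cube) auto
  then show "norm (poly (h Z) s) \<le> growth" by (simp add: growth_def algebra_simps)
qed

text \<open>Cauchy at radius 1/2 bounds the coefficient at all sign vectors, as its Fourier
  expansion demands.\<close>

lemma low_part_correlation:
  assumes t: "2 * t \<le> M" and k: "k \<le> m"
  shows "norm (\<Sum>X\<in>Pow {..<2 * t}. of_real (bent t X) * coeff (h (lift X)) k)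
    \<le> 2 ^ t * (growth * 2 ^ k) * (real (6 * M\<^sup>2) + 1) ^ ((d + m) * L)"
proof -
  have "(d + k) * L \<le> (d + m) * L" using k by simp
  then have low: "lowdeg V ((d + m) * L) (\<lambda>Z. coeff (h Z) k)"
    using graded_h k unfolding graded_def by (meson lowdeg_mono)
  have "norm (coeff (h Z) k) \<le> growth * 2 ^ k" for Z
    using norm_coeff_h_le[of "1 / 2" Z k] norm_poly_\<xi>_le_half by (simp add: power_divide)
  then show ?thesis
    unfolding lift_def card_V[symmetric]
    by (intro lowdeg_correlation_le[where U = "{..<M}"] low bent_flat) (use A_sub in auto)
qed

text \<open>On lifts Cauchy applies at a radius of at least 2, so the coefficients beyond
  \<open>m\<close> are dominated by a geometric series.\<close>

lemma tail_le:
  assumes X: "X \<subseteq> {..<M}"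
  shows "norm (poly (h (lift X)) 1 - (\<Sum>k\<le>m. coeff (h (lift X)) k)) \<le> growth / ((4 / 3) ^ L / 2) ^ m"
proof -
  define \<rho> :: real where "\<rho> = (4 / 3) ^ L / 2"
  have \<rho>: "\<rho> \<ge> 2" using L_ge by (simp add: \<rho>_def)
  let ?p = "h (lift X)" and ?n = "max (degree (h (lift X))) m"
  have "poly ?p 1 = (\<Sum>k\<le>?n. coeff ?p k)"
    unfolding poly_altdef by (simp, rule sum.mono_neutral_left) (auto simp: coeff_eq_0)
  also have "{..?n} = {..m} \<union> {m<..?n}" by auto
  also have "(\<Sum>k\<in>{..m} \<union> {m<..?n}. coeff ?p k) = (\<Sum>k\<le>m. coeff ?p k) + (\<Sum>k\<in>{m<..?n}. coeff ?p k)"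
    by (rule sum.union_disjoint) auto
  finally have "norm (poly ?p 1 - (\<Sum>k\<le>m. coeff ?p k)) = norm (\<Sum>k\<in>{m<..?n}. coeff ?p k)" by simp
  also have "\<dots> \<le> (\<Sum>k\<in>{m<..?n}. growth * (1 / \<rho>) ^ k)"
  proof (rule sum_norm_le)
    fix k
    have "norm (coeff ?p k) \<le> growth / \<rho> ^ k"
      by (rule norm_coeff_h_le) (use \<rho> norm_poly_\<xi>_lift_le[OF X] in \<open>auto simp: \<rho>_def\<close>)
    then show "norm (coeff ?p k) \<le> growth * (1 / \<rho>) ^ k" by (simp add: power_divide)
  qed
  also have "\<dots> = growth * (\<Sum>k\<in>{m<..?n}. (1 / \<rho>) ^ k)" by (simp add: sum_distrib_left)
  also have "\<dots> \<le> growth * (1 / \<rho>) ^ m"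
    using \<rho> by (intro mult_left_mono sum_power_tail_le growth_nonneg) (auto simp: field_simps)
  finally show ?thesis by (simp add: power_divide \<rho>_def)
qed

text \<open>At 1 the polynomial \<open>h (lift X)\<close> is split at degree \<open>m\<close>: low
  coefficients are correlated one by one, the rest is bounded pointwise over the
  \<open>4 ^ t\<close> sets.\<close>

lemma correlation_le:
  assumes t: "2 * t \<le> M"
  shows "norm (\<Sum>X\<in>Pow {..<2 * t}. of_real (bent t X) * Q (\<lambda>i. of_bool (encode X \<le> i)))
    \<le> 2 ^ t * growth * 2 ^ (m + 1) * (real (6 * M\<^sup>2) + 1) ^ ((d + m) * L)
      + 4 ^ t * (growth / ((4 / 3) ^ L / 2) ^ m)"
proof -
  let ?P = "Pow {..<2 * t}"
  let ?low = "\<lambda>X. \<Sum>k\<le>m. coeff (h (lift X)) k"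
  let ?E = "(real (6 * M\<^sup>2) + 1) ^ ((d + m) * L)"
  have sub: "X \<subseteq> {..<M}" if "X \<in> ?P" for X using that t by auto
  have L: "L > 0" using L_ge by (cases L) auto
  have Q: "Q (\<lambda>i. of_bool (encode X \<le> i)) = poly (h (lift X)) 1" if X: "X \<in> ?P" for X
    unfolding poly_h
  proof (rule Q_cong)
    fix i a assume "a \<in> I" "i \<in> K a"
    then have "i < 2 ^ (M + 1)" using K_sub by blast
    then show "of_bool (encode X \<le> i) = poly (\<xi> i (lift X)) 1"
      using poly_\<xi>_lift_1[OF L sub[OF X]] by simp
  qed
  have "norm (\<Sum>X\<in>?P. of_real (bent t X) * ?low X)
      = norm (\<Sum>k\<le>m. \<Sum>X\<in>?P. of_real (bent t X) * coeff (h (lift X)) k)"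
    by (subst sum.swap) (simp add: sum_distrib_left)
  also have "\<dots> \<le> (\<Sum>k\<le>m. 2 ^ t * (growth * 2 ^ k) * ?E)"
    by (rule sum_norm_le) (use low_part_correlation[OF t] in auto)
  also have "\<dots> = 2 ^ t * growth * ?E * (\<Sum>k\<le>m. 2 ^ k)"
    unfolding sum_distrib_left by (rule sum.cong) (simp_all add: mult_ac)
  also have "\<dots> \<le> 2 ^ t * growth * ?E * 2 ^ (m + 1)"
  proof (rule mult_left_mono)
    show "(\<Sum>k\<le>m. 2 ^ k) \<le> (2 :: real) ^ (m + 1)" by (induction m) auto
  qed (use growth_nonneg in simp)
  finally have low: "norm (\<Sum>X\<in>?P. of_real (bent t X) * ?low X) \<le> 2 ^ t * growth * 2 ^ (m + 1) * ?E"
    by (simp add: mult_ac)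
  have "norm (\<Sum>X\<in>?P. of_real (bent t X) * (poly (h (lift X)) 1 - ?low X))
      \<le> (\<Sum>X\<in>?P. growth / ((4 / 3) ^ L / 2) ^ m)"
  proof (rule sum_norm_le)
    fix X assume X: "X \<in> ?P"
    have "\<bar>bent t X\<bar> = 1" using bent_cases[of t X] by auto
    then show "norm (of_real (bent t X) * (poly (h (lift X)) 1 - ?low X)) \<le> growth / ((4 / 3) ^ L / 2) ^ m"
      using tail_le[OF sub[OF X]] by (simp add: norm_mult)
  qed
  also have "\<dots> = 4 ^ t * (growth / ((4 / 3) ^ L / 2) ^ m)"
    by (simp add: card_Pow power_mult)
  finally have high: "norm (\<Sum>X\<in>?P. of_real (bent t X) * (poly (h (lift X)) 1 - ?low X))
      \<le> 4 ^ t * (growth / ((4 / 3) ^ L / 2) ^ m)" .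
  have "(\<Sum>X\<in>?P. of_real (bent t X) * Q (\<lambda>i. of_bool (encode X \<le> i)))
     = (\<Sum>X\<in>?P. of_real (bent t X) * ?low X) + (\<Sum>X\<in>?P. of_real (bent t X) * (poly (h (lift X)) 1 - ?low X))"
    unfolding sum.distrib[symmetric] by (intro sum.cong refl) (simp add: Q algebra_simps)
  then show ?thesis using norm_triangle_le[OF add_mono[OF low high]] by simp
qed

end

section \<open>Application to ordered search\<close>

lemma parity_append: "parity (xs @ ys) = (parity xs \<noteq> parity ys)"
  by (induction xs) (auto simp: parity_def)

lemma parity_binary_rep_Suc:
  "parity (binary_rep (Suc M) k) = (parity (binary_rep M (k div 2)) \<noteq> odd k)"
proof -
  have "[0..<Suc M] = 0 # map Suc [0..<M]" by (simp only: upt_conv_Cons map_Suc_upt zero_less_Suc)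
  then have "rev [0..<Suc M] = map Suc (rev [0..<M]) @ [0]" by (simp add: rev_map)
  then have "binary_rep (Suc M) k = map (\<lambda>j. bit k (Suc j)) (rev [0..<M]) @ [odd k]"
    by (simp add: binary_rep_def bit_0 o_def del: upt_Suc)
  also have "\<dots> = binary_rep M (k div 2) @ [odd k]"
    by (simp add: binary_rep_def bit_Suc)
  finally show ?thesis by (simp add: parity_append) (simp add: parity_def)
qed

text \<open>Positive powers do not change bits, so every polynomial acts on the cube as a
  multiaffine form.\<close>

lemma monom_eval_squarefree: "monom_eval mo y = (\<Prod>i\<in>Poly_Mapping.keys mo. of_bool (y ! i))"
  unfolding monom_eval_def
  by (rule prod.cong) (auto simp: in_keys_iff power_0_left)

lemma card_keys_le_total_degree:
  assumes "mo \<in> Poly_Mapping.keys p"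
  shows "card (Poly_Mapping.keys mo) \<le> total_degree p"
proof -
  have "card (Poly_Mapping.keys mo) = (\<Sum>i\<in>Poly_Mapping.keys mo. 1)" by simp
  also have "\<dots> \<le> monom_degree mo"
    unfolding monom_degree_def by (rule sum_mono) (auto simp: in_keys_iff)
  also have "\<dots> \<le> total_degree p"
    unfolding total_degree_def using assms by (intro Max_ge) auto
  finally show ?thesis .
qed

lemma map_le_upt_eq_step_input: "k < N \<Longrightarrow> map (\<lambda>i. k \<le> i) [0..<N] = step_input N k"
  by (rule nth_equalityI) (auto simp: step_input_def nth_append)

text \<open>At every encoded input \<open>p - 1/2\<close> has the sign of \<open>- bent t X\<close>
  and size at least \<open>\<gamma>\<close>, so its correlation with \<open>bent\<close> is at least
  \<open>4 ^ t * \<gamma>\<close>; \<open>correlation_le\<close> bounds it from above.\<close>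

lemma approximation_advantage_le:
  assumes p: "approximates (2 ^ (M + 1)) (1 / 2 - \<gamma>) (ordered_search (M + 1)) p"
    and \<gamma>: "0 < \<gamma>" and d: "total_degree p \<le> d" "d > 0"
    and M: "M > 0" "2 * t \<le> M" and L: "(4 / 3) ^ L / 2 \<ge> (2 :: real)"
  shows "\<gamma> \<le> (864 * (real M + 1)) ^ d * 2 ^ (m + 1) * (real (6 * M\<^sup>2) + 1) ^ ((d + m) * L) / 2 ^ t
      + (864 * (real M + 1)) ^ d / ((4 / 3) ^ L / 2) ^ m"
proof -
  let ?N = "2 ^ (M + 1) :: nat"
  obtain A :: "nat \<Rightarrow> nat set" where A: "\<And>r. A r \<subseteq> {..<M}"
    "\<And>D. D \<subseteq> {..<M} \<Longrightarrow> D \<noteq> {} \<Longrightarrow> (\<Sum>r<6 * M. chi (A r) D) \<le> 3 * M"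
    using small_bias_family[of "{..<M}"] by auto
  \<comment> \<open>This last digit makes the parity of \<open>encode X\<close> true exactly when
    \<open>bent t X = - 1\<close>.\<close>
  define b where "b X = (parity (binary_rep M (set_encode X)) \<noteq> (bent t X = - 1))" for X
  \<comment> \<open>\<open>None\<close> is an additional constant monomial -1/2, so the form is
    \<open>p - 1/2\<close>, bounded by 1 on the cube.\<close>
  define I where "I = insert None (Some ` Poly_Mapping.keys p)"
  define c where "c a = (case a of None \<Rightarrow> - 1 / 2 | Some mo \<Rightarrow> complex_of_real (Poly_Mapping.lookup p mo))" for a
  define K where "K a = (case a of None \<Rightarrow> {} | Some mo \<Rightarrow> Poly_Mapping.keys mo)"
    for a :: "(nat \<Rightarrow>\<^sub>0 nat) option"
  interpret multiaffine I c K d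
  proof
    show "card (K a) \<le> d" if "a \<in> I" for a
      using that order_trans[OF card_keys_le_total_degree d(1)] by (auto simp: I_def K_def)
  qed (auto simp: I_def K_def d split: option.splits)
  have vars: "K a \<subseteq> {..<?N}" if "a \<in> I" for a
  proof -
    have "Poly_Mapping.keys mo \<subseteq> {..<?N}" if "mo \<in> Poly_Mapping.keys p" for mo
      using that p unfolding approximates_def mpoly_vars_def by blast
    then show ?thesis using \<open>a \<in> I\<close> by (cases a) (auto simp: I_def K_def simp del: power_Suc lessThan_iff)
  qed
  have eval: "Q (\<lambda>i. of_bool (y i)) = of_real (mpoly_eval p (map y [0..<?N]) - 1 / 2)" for y
  proof -
    have "(\<Prod>i\<in>Poly_Mapping.keys mo. of_bool (y i)) = complex_of_real (monom_eval mo (map y [0..<?N]))"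
      if "mo \<in> Poly_Mapping.keys p" for mo
      using vars[of "Some mo"] that unfolding monom_eval_squarefree of_real_prod
      by (intro prod.cong refl) (auto simp: I_def K_def subset_iff simp del: upt_Suc)
    then have "(\<Sum>mo\<in>Poly_Mapping.keys p. of_real (Poly_Mapping.lookup p mo) * (\<Prod>i\<in>Poly_Mapping.keys mo. of_bool (y i)))
      = complex_of_real (mpoly_eval p (map y [0..<?N]))"
      unfolding mpoly_eval_def of_real_sum of_real_mult by (intro sum.cong refl) simp
    then show ?thesis
      unfolding Q_def unfolding I_def by (simp add: sum.reindex c_def K_def)
  qed
  interpret interpolated I c K d M A L m b
  proof
    show "norm (Q (\<lambda>i. of_bool (y i))) \<le> 1" for y
    proof -
      have "- (1 / 2 - \<gamma>) \<le> mpoly_eval p (map y [0..<?N]) \<and> mpoly_eval p (map y [0..<?N]) \<le> 1 + (1 / 2 - \<gamma>)"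
        using p by (simp add: approximates_def del: upt_Suc)
      then have "\<bar>mpoly_eval p (map y [0..<?N]) - 1 / 2\<bar> \<le> 1" using \<gamma> by linarith
      then show ?thesis unfolding eval norm_of_real .
    qed
  qed (use A M L vars in auto)
  have adv: "\<gamma> \<le> - bent t X * (mpoly_eval p (map (\<lambda>i. encode X \<le> i) [0..<?N]) - 1 / 2)"
    if X: "X \<subseteq> {..<2 * t}" for X
  proof -
    have "set_encode X < 2 ^ M" using X M by (intro set_encode_less_power) auto
    then have k: "encode X < ?N" by (auto simp: encode_def of_bool_def)
    have par: "parity (binary_rep (M + 1) (encode X)) \<longleftrightarrow> bent t X = - 1"
      by (auto simp: parity_binary_rep_Suc encode_def b_def)
    have "step_input ?N (encode X) \<in> dom (ordered_search (M + 1))"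
      using ordered_search_step_input[OF k] by auto
    then have "\<bar>mpoly_eval p (step_input ?N (encode X)) -
        of_bool (the (ordered_search (M + 1) (step_input ?N (encode X))))\<bar> \<le> 1 / 2 - \<gamma>"
      using p unfolding approximates_def by blast
    then have "\<bar>mpoly_eval p (step_input ?N (encode X)) - of_bool (bent t X = - 1)\<bar> \<le> 1 / 2 - \<gamma>"
      unfolding ordered_search_step_input[OF k] option.sel par .
    then show ?thesis
      unfolding map_le_upt_eq_step_input[OF k] using bent_cases[of t X] by (auto simp: abs_le_iff)
  qed
  have "4 ^ t * \<gamma> = (\<Sum>X\<in>Pow {..<2 * t}. \<gamma>)" by (simp add: card_Pow power_mult)
  also have "\<dots> \<le> (\<Sum>X\<in>Pow {..<2 * t}. - bent t X * (mpoly_eval p (map (\<lambda>i. encode X \<le> i) [0..<?N]) - 1 / 2))"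
    by (rule sum_mono) (use adv in auto)
  also have "\<dots> \<le> norm (\<Sum>X\<in>Pow {..<2 * t}. of_real (bent t X) * Q (\<lambda>i. of_bool (encode X \<le> i)))"
    unfolding eval of_real_mult[symmetric] of_real_sum[symmetric] norm_of_real
    by (simp add: sum_negf del: upt_Suc)
  also have "\<dots> \<le> 2 ^ t * growth * 2 ^ (m + 1) * (real (6 * M\<^sup>2) + 1) ^ ((d + m) * L)
      + 4 ^ t * (growth / ((4 / 3) ^ L / 2) ^ m)"
    by (rule correlation_le[OF M(2)])
  also have "\<dots> = 4 ^ t * (growth * 2 ^ (m + 1) * (real (6 * M\<^sup>2) + 1) ^ ((d + m) * L) / 2 ^ t
      + growth / ((4 / 3) ^ L / 2) ^ m)"
  proof -
    have "(4 :: real) ^ t = 2 ^ t * 2 ^ t" by (simp add: power_mult_distrib[symmetric])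
    then show ?thesis by (simp add: distrib_left)
  qed
  finally show ?thesis by (simp add: growth_def add.commute)
qed

text \<open>In the first summand the leading exponent 144 m l^2 is at most 0.36 n, which loses
  against \<open>t\<close> near n/2. In the second, 2 l m - (4 l - 1) m is at most - m l, and
  \<open>big\<close> makes m l exceed n / l^2 + 1.\<close>

lemma parameter_bound:
  fixes n d m t L :: nat and l :: real
  defines "l \<equiv> log 2 n"
  assumes n: "n \<ge> 864" and l_ge: "l \<ge> 10"
    and big: "n / (400 * l) - l > n / l\<^sup>2 + 1"
    and m: "real m \<le> n / (400 * l\<^sup>2)" "n / (400 * l\<^sup>2) - 1 \<le> real m" and d: "d \<le> m"
    and L: "L = 12 * nat \<lceil>l\<rceil>" and t: "real t \<ge> n / 2 - 1"
  shows "(4 / 3) ^ L / 2 \<ge> (2 :: real)"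
    and "(864 * real n) ^ d * 2 ^ (m + 1) * (6 * (real n - 1)\<^sup>2 + 1) ^ ((d + m) * L) / 2 ^ t
      + (864 * real n) ^ d / ((4 / 3) ^ L / 2) ^ m < 2 powr (- (n / l\<^sup>2))"
proof -
  have n_powr: "real n = 2 powr l" using n by (simp add: l_def)
  have pow: "(2 powr x) ^ k = 2 powr (x * real k)" for x :: real and k
    by (simp add: powr_powr[symmetric] powr_realpow)
  \<comment> \<open>Twelve factors 4/3 exceed 16, hence \<open>(4 / 3) ^ L\<close> is at least
    n^4.\<close>
  have "(2 powr (4 * l)) \<le> (4 / 3) ^ L"
  proof -
    have "2 powr (4 * l) \<le> 2 powr (4 * real (nat \<lceil>l\<rceil>))" using l_ge by simp
    also have "\<dots> = 16 ^ nat \<lceil>l\<rceil>" by (simp add: powr_powr[symmetric] powr_realpow)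
    also have "\<dots> \<le> ((4 / 3) ^ 12) ^ nat \<lceil>l\<rceil>" by (intro power_mono) (auto simp: power_divide)
    finally show ?thesis by (simp add: L power_mult)
  qed
  moreover have "2 powr (4 * l - 1) = 2 powr (4 * l) / 2" by (simp add: powr_diff)
  ultimately have \<rho>: "2 powr (4 * l - 1) \<le> (4 / 3) ^ L / 2" by simp
  have "(2 :: real) powr 1 \<le> 2 powr (4 * l - 1)" using l_ge by (subst powr_le_cancel_iff) auto
  then show "(4 / 3) ^ L / 2 \<ge> (2 :: real)" using \<rho> by simp
  have growth: "(864 * real n) ^ d \<le> 2 powr (2 * l * m)"
  proof -
    have "(864 * real n) ^ d \<le> (real n * real n) ^ d" using n by (intro power_mono mult_right_mono) auto
    also have "\<dots> \<le> (real n * real n) ^ m"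
      using n d by (intro power_increasing) (auto simp: one_le_mult_iff mult_ge1_I)
    also have "real n * real n = 2 powr (2 * l)" by (simp add: n_powr powr_add[symmetric])
    finally show ?thesis by (simp add: pow)
  qed
  have L_le: "real L \<le> 24 * l"
  proof -
    have "real (nat \<lceil>l\<rceil>) \<le> l + 1" using l_ge by linarith
    then have "real (nat \<lceil>l\<rceil>) \<le> 2 * l" using l_ge by linarith
    then show ?thesis unfolding L by simp
  qed
  \<comment> \<open>The base is at most n^3 = 2^(3 l) and the exponent at most 2 m * 24 l; the
    constant is 3 * 2 * 24.\<close>
  have E: "(6 * (real n - 1)\<^sup>2 + 1) ^ ((d + m) * L) \<le> 2 powr (144 * (m * l\<^sup>2))"
  proof -
    have "6 * (real n - 1)\<^sup>2 + 1 \<le> real n * real n * real n"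
    proof -
      have "6 * (real n - 1)\<^sup>2 + 1 \<le> 7 * (real n * real n)"
      proof -
        have "(real n - 1)\<^sup>2 \<le> (real n)\<^sup>2" using n by (intro power_mono) auto
        moreover have "1 \<le> (real n)\<^sup>2" using n by (intro one_le_power) auto
        ultimately show ?thesis by (simp add: power2_eq_square)
      qed
      also have "\<dots> \<le> real n * (real n * real n)" using n by (intro mult_right_mono) auto
      finally show ?thesis by (simp add: mult_ac)
    qed
    also have "\<dots> = 2 powr (3 * l)" by (simp add: n_powr powr_add[symmetric])
    finally have "(6 * (real n - 1)\<^sup>2 + 1) ^ ((d + m) * L) \<le> (2 powr (3 * l)) ^ ((d + m) * L)"
      by (intro power_mono) auto
    also have "\<dots> = 2 powr (3 * l * (real (d + m) * real L))" by (simp add: pow)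
    also have "\<dots> \<le> 2 powr (3 * l * ((2 * m) * (24 * l)))"
      using l_ge d L_le by (subst powr_le_cancel_iff, simp, intro mult_left_mono mult_mono) auto
    finally show ?thesis by (simp add: power2_eq_square mult_ac)
  qed
  have ml2: "m * l\<^sup>2 \<le> n / 400" using m l_ge by (simp add: field_simps)
  have ml: "m * l \<le> n / 4000"
  proof -
    have "m * l * 10 \<le> m * l * l" using l_ge by (intro mult_left_mono) auto
    then show ?thesis using ml2 by (simp add: power2_eq_square mult_ac)
  qed
  have m1: "m \<le> n / 4000"
  proof -
    have "real m * 1 \<le> m * l" using l_ge by (intro mult_left_mono) auto
    then show ?thesis using ml by simp
  qed
  have nl: "n / l\<^sup>2 \<le> n / 100"
  proof -
    have "10 ^ 2 \<le> l\<^sup>2" using l_ge by (intro power_mono) auto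
    then show ?thesis by (intro divide_left_mono) auto
  qed
  have "(864 * real n) ^ d * 2 ^ (m + 1) * (6 * (real n - 1)\<^sup>2 + 1) ^ ((d + m) * L) / 2 ^ t
      \<le> 2 powr (2 * l * m) * 2 powr (m + 1) * 2 powr (144 * (m * l\<^sup>2)) / 2 powr t"
    unfolding powr_realpow[OF zero_less_numeral] using growth E
    by (intro divide_right_mono mult_mono) auto
  also have "\<dots> = 2 powr (2 * l * m + (m + 1) + 144 * (m * l\<^sup>2) - t)"
    by (simp add: powr_add powr_diff)
  also have "\<dots> < 2 powr (- (n / l\<^sup>2) - 1)"
    using ml2 ml m1 nl t n by (intro powr_less_mono) (auto simp: mult_ac)
  finally have 1: "(864 * real n) ^ d * 2 ^ (m + 1) * (6 * (real n - 1)\<^sup>2 + 1) ^ ((d + m) * L) / 2 ^ t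
      < 2 powr (- (n / l\<^sup>2) - 1)" .
  have "(864 * real n) ^ d / ((4 / 3) ^ L / 2) ^ m \<le> 2 powr (2 * l * m) / (2 powr (4 * l - 1)) ^ m"
    using growth \<rho> by (intro frac_le power_mono) auto
  also have "\<dots> = 2 powr (2 * l * m - (4 * l - 1) * m)" unfolding pow by (simp only: powr_diff)
  also have "\<dots> \<le> 2 powr (- (m * l))"
  proof -
    have "real m * 1 \<le> m * l" using l_ge by (intro mult_left_mono) auto
    then show ?thesis by (simp add: algebra_simps)
  qed
  also have "\<dots> \<le> 2 powr (- (n / l\<^sup>2) - 1)"
  proof -
    have "(n / (400 * l\<^sup>2) - 1) * l \<le> m * l" using m l_ge by (intro mult_right_mono) auto
    moreover have "(n / (400 * l\<^sup>2) - 1) * l = n / (400 * l) - l"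
      using l_ge by (simp add: field_simps power2_eq_square)
    ultimately show ?thesis using big by simp
  qed
  finally have 2: "(864 * real n) ^ d / ((4 / 3) ^ L / 2) ^ m \<le> 2 powr (- (n / l\<^sup>2) - 1)" .
  \<comment> \<open>Each summand gets half of the target, hence the -1 in both exponents.\<close>
  have "2 powr (- (n / l\<^sup>2) - 1) + 2 powr (- (n / l\<^sup>2) - 1) = 2 powr (- (n / l\<^sup>2))"
    by (simp add: powr_diff)
  then show "(864 * real n) ^ d * 2 ^ (m + 1) * (6 * (real n - 1)\<^sup>2 + 1) ^ ((d + m) * L) / 2 ^ t
      + (864 * real n) ^ d / ((4 / 3) ^ L / 2) ^ m < 2 powr (- (n / l\<^sup>2))"
    using 1 2 by linarith
qed

theorem theorem3p7:
  "\<exists>c :: real. c > 0 \<and> (\<exists>n\<^sub>0 :: nat. \<forall>n \<ge> n\<^sub>0. \<forall>\<gamma> :: real. 0 < \<gamma> \<and> \<gamma> < 1 / 2 \<longrightarrow>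
     real (approx_degree (2 ^ n) (1 / 2 - \<gamma>) (ordered_search n))
       \<ge> c * (real n / (log 2 (real n))\<^sup>2 - log 2 (1 / \<gamma>)))"
proof -
  have "eventually (\<lambda>n::nat. log 2 (real n) \<ge> 10 \<and>
      real n / (400 * log 2 (real n)) - log 2 (real n) > real n / (log 2 (real n))\<^sup>2 + 1 \<and>
      real n / (800 * (log 2 (real n))\<^sup>2) \<ge> 1) at_top" (is "eventually ?P at_top")
    by (intro eventually_conj; real_asymp)
  then obtain n1 where n1: "?P n" if "n \<ge> n1" for n
    by (auto simp only: eventually_sequentially)
  have main: "real (approx_degree (2 ^ n) (1 / 2 - \<gamma>) (ordered_search n))
       \<ge> 1 / 800 * (real n / (log 2 (real n))\<^sup>2 - log 2 (1 / \<gamma>))"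
    if n: "n \<ge> max n1 864" and \<gamma>: "0 < \<gamma>" "\<gamma> < 1 / 2" for n \<gamma>
  proof (cases "real n / (log 2 (real n))\<^sup>2 \<le> log 2 (1 / \<gamma>)")
    \<comment> \<open>The claimed lower bound is not positive here.\<close>
    case True
    then show ?thesis by (intro order_trans[OF _ of_nat_0_le_iff]) simp
  next
    case False
    define l where "l = log 2 (real n)"
    have l: "l \<ge> 10" "n / (400 * l) - l > n / l\<^sup>2 + 1" "n / (800 * l\<^sup>2) \<ge> 1"
      using n1[of n] n by (auto simp: l_def)
    define m where "m = nat \<lfloor>n / (400 * l\<^sup>2)\<rfloor>"
    define L where "L = 12 * nat \<lceil>l\<rceil>"
    define t where "t = (n - 1) div 2"
    have m: "real m \<le> n / (400 * l\<^sup>2)" "n / (400 * l\<^sup>2) - 1 \<le> real m"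
      using l unfolding m_def by linarith+
    have t: "real t \<ge> n / 2 - 1" "2 * t \<le> n - 1" using n unfolding t_def by linarith+
    have "\<exists>d p. approximates (2 ^ n) (1 / 2 - \<gamma>) (ordered_search n) p \<and> total_degree p = d"
      using ex_approximates[of "1 / 2 - \<gamma>" "ordered_search n" "2 ^ n"] length_dom_ordered_search \<gamma> by auto
    from LeastI_ex[OF this] obtain p where
      p: "approximates (2 ^ n) (1 / 2 - \<gamma>) (ordered_search n) p"
        "total_degree p = approx_degree (2 ^ n) (1 / 2 - \<gamma>) (ordered_search n)"
      unfolding approx_degree_def by blast
    \<comment> \<open>The added 1 makes \<open>d\<close> positive for the interpolation; it costs
      nothing, since d > m still gives degree at least \<open>m\<close>.\<close>
    define d where "d = total_degree p + 1"
    have "\<not> d \<le> m"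
    proof
      assume d: "d \<le> m"
      note bounds = parameter_bound[of n m d L t, folded l_def, OF _ l(1,2) m d L_def t(1)]
      have "\<gamma> \<le> (864 * (real (n - 1) + 1)) ^ d * 2 ^ (m + 1) * (real (6 * (n - 1)\<^sup>2) + 1) ^ ((d + m) * L) / 2 ^ t
          + (864 * (real (n - 1) + 1)) ^ d / ((4 / 3) ^ L / 2) ^ m"
        by (rule approximation_advantage_le[of "n - 1" \<gamma> p])
           (use p \<gamma> n t bounds(1) in \<open>auto simp: d_def\<close>)
      also have "\<dots> = (864 * real n) ^ d * 2 ^ (m + 1) * (6 * (real n - 1)\<^sup>2 + 1) ^ ((d + m) * L) / 2 ^ t
          + (864 * real n) ^ d / ((4 / 3) ^ L / 2) ^ m"
        using n by (simp add: of_nat_diff)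
      also have "\<dots> < 2 powr (- (n / l\<^sup>2))" using bounds(2) n by simp
      also have "\<dots> < \<gamma>"
      proof -
        have "log 2 (1 / \<gamma>) < n / l\<^sup>2" using False by (simp add: l_def)
        then have "- (n / l\<^sup>2) < log 2 \<gamma>" using \<gamma> by (simp add: log_divide)
        then show ?thesis using \<gamma> by (simp add: less_log_iff)
      qed
      finally show False .
    qed
    then have "real m \<le> real (approx_degree (2 ^ n) (1 / 2 - \<gamma>) (ordered_search n))"
      using p(2) by (simp add: d_def)
    \<comment> \<open>The rounding loss of 1 is at most half of n / (400 l^2), which turns 1/400
      into 1/800.\<close>
    moreover have "n / (400 * l\<^sup>2) - 1 \<ge> 1 / 800 * (n / l\<^sup>2)" using l by (simp add: field_simps)
    moreover have "log 2 (1 / \<gamma>) \<ge> 0" using \<gamma> by simp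
    ultimately show ?thesis using m(2) unfolding l_def[symmetric] by (simp add: algebra_simps)
  qed
  show ?thesis
    by (rule exI[of _ "1 / 800"], intro conjI exI[of _ "max n1 864"]) (use main in auto)
qed

end
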